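(* Let $0<N<N_1<\cdots<N_M$ be integers. Let $$L=\mathcal S^{-N}+u_1\mathcal S^{-N_1}+\cdots+u_M\mathcal S^{-N_M},$$ where $u_1,\dots,u_M$ are free generators over $\mathbb C$ of the commutative algebra $\mathcal A$ of difference polynomials. Put $p=\gcd(N_1-N,\dots,N_M-N)$, $q=p/\gcd(p,N)$, $m=(N_M-N)/p$. Suppose that $L$ admits infinitely many linearly independent Lax flows. Then the support of $L$ is arithmetic, i.e. $\mathrm{supp}(L)=\{-N,-N-p,\dots,-N-mp\}$. Moreover, there exists a unique hierarchy of commuting Lax flows on $\mathcal A$ $$\partial_k(L)=[(L^{-qk})_+,L],\qquad k>0.$$ This hierarchy possesses infinitely many conserved densities given by $$h_k=\mathrm{Res}\,L^{-qk},\qquad k>0.$$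
   Context: $\mathcal A=\mathbb C[\mathcal S^j(u_i)\mid 1\le i\le M,\ j\in\mathbb Z]$ is the polynomial ring over $\mathbb C$ in the algebraically independent variables $\mathcal S^j(u_i)$, and $\mathcal S$ is the shift automorphism mapping $\mathcal S^j(u_i)$ to $\mathcal S^{j+1}(u_i)$. The algebra of difference operators $\mathcal A[\mathcal S,\mathcal S^{-1}]$ (Laurent polynomials in $\mathcal S$ with coefficients in $\mathcal A$ written on the left) and the algebra of pseudodifference operators (formal Laurent series in $\mathcal S^{-1}$ with coefficients in $\mathcal A$, i.e. finitely many positive powers of $\mathcal S$ and possibly infinitely many negative ones) have the product $a\mathcal S^n\,b\mathcal S^{m}=a\,\mathcal S^n(b)\,\mathcal S^{n+m}$. The monic operator $L$ has a unique inverse among pseudodifference operators, so $L^{-j}$ is defined for all $j\ge0$. For $P=\sum_n a_n\mathcal S^n$, $\mathrm{supp}(P)=\{n:a_n\neq0\}$, $P_+=\sum_{n\ge0}a_n\mathcal S^n$ and $\mathrm{Res}\,P=a_0$. A Lax flow is a derivation $\partial$ of $\mathcal A$ commuting with $\mathcal S$ whose action on the generators $u_i$ is given by $\partial(L)=[A,L]$, with $\partial(L)=\sum_i\partial(u_i)\mathcal S^{-N_i}$, where the auxiliary operator $A\in\mathcal A[\mathcal S,\mathcal S^{-1}]$ is such that $\mathrm{supp}([A,L])\subset\mathrm{supp}(L)$. That the $h_{k}$ are conserved densities of the hierarchy means that $\partial_k(h_{k'})$ lies in the image of $\mathcal S-1$ for all $k,k'>0$. *)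

theory Defs
  imports Complex_Main "HOL-Library.Poly_Mapping" "HOL-Library.Function_Algebras"
begin

section \<open>Difference polynomials\<close>

text \<open>
  A difference polynomial is a complex polynomial in the variables indexed by
  \<^typ>\<open>'m \<times> int\<close>; the pair \<open>(i, j)\<close> stands for \<open>S\<^sup>j(u\<^sub>i)\<close>. The index set of the
  generators is the type \<open>'m\<close>; when \<open>'m\<close> is a finite linear order it plays the role of
  \<open>{1, \<dots>, M}\<close> with \<open>M = CARD('m)\<close>. Multiplication of the type below is the library's
  convolution product, so it is the polynomial ring.
\<close>

type_synonym 'm dpoly = "('m \<times> int \<Rightarrow>\<^sub>0 nat) \<Rightarrow>\<^sub>0 complex"

definition dconst :: "complex \<Rightarrow> 'm dpoly" where
  "dconst c = Poly_Mapping.single 0 c"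

definition dvar :: "'m \<Rightarrow> int \<Rightarrow> 'm dpoly" where
  "dvar i j = Poly_Mapping.single (Poly_Mapping.single (i, j) 1) 1"

text \<open>
  \<open>shift n\<close> is the \<open>n\<close>-th power of the shift automorphism. As \<open>map_key\<close> acts by
  precomposition, the exponent of \<open>(i, j)\<close> in the shifted monomial is the exponent of
  \<open>(i, j - n)\<close> in the original one; likewise on the level of coefficients, whence the
  negated argument in the second definition.
\<close>

definition mono_shift :: "int \<Rightarrow> ('m \<times> int \<Rightarrow>\<^sub>0 nat) \<Rightarrow> ('m \<times> int \<Rightarrow>\<^sub>0 nat)" where
  "mono_shift n = Poly_Mapping.map_key (\<lambda>(i, j). (i, j - n))"

definition shift :: "int \<Rightarrow> 'm dpoly \<Rightarrow> 'm dpoly" where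
  "shift n = Poly_Mapping.map_key (mono_shift (- n))"

lemma inj_index_shift: "inj (\<lambda>(i :: 'm, j :: int). (i, j - n))"
  by (auto simp: inj_def)

lemma mono_shift_plus: "mono_shift n (x + y) = mono_shift n x + mono_shift n y"
  unfolding mono_shift_def by (rule map_key_plus[OF inj_index_shift])

lemma mono_shift_0 [simp]: "mono_shift n 0 = 0"
  unfolding mono_shift_def by (rule map_key_zero[OF inj_index_shift])

lemma mono_shift_shift: "mono_shift m (mono_shift n x) = mono_shift (m + n) x"
proof -
  have "(\<lambda>(i :: 'a, j :: int). (i, j - n)) \<circ> (\<lambda>(i, j). (i, j - m)) = (\<lambda>(i, j). (i, j - (m + n)))"
    by (auto simp: fun_eq_iff)
  then show ?thesis
    unfolding mono_shift_def by (simp add: map_key_compose[OF inj_index_shift inj_index_shift])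
qed

lemma mono_shift_id [simp]: "mono_shift 0 x = x"
proof -
  have "(\<lambda>(i :: 'a, j :: int). (i, j - 0)) = (\<lambda>x. x)" by auto
  then show ?thesis unfolding mono_shift_def by (simp only: map_key_id)
qed

lemma mono_shift_single:
  "mono_shift n (Poly_Mapping.single (i, j) e) = Poly_Mapping.single (i, j + n) e"
  using map_key_single[OF inj_index_shift, of n "(i, j + n)" e]
  unfolding mono_shift_def by simp

lemma inj_mono_shift: "inj (mono_shift n)"
  by (rule inj_on_inverseI[where g = "mono_shift (- n)"]) (simp add: mono_shift_shift)

lemma shift_single: "shift n (Poly_Mapping.single x c) = Poly_Mapping.single (mono_shift n x) c"
  using map_key_single[OF inj_mono_shift, of "- n" "mono_shift n x" c]
  unfolding shift_def by (simp add: mono_shift_shift)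

lemma shift_dvar: "shift n (dvar i j) = dvar i (j + n)"
  by (simp add: dvar_def shift_single mono_shift_single)

lemma shift_dconst: "shift n (dconst c) = dconst c"
  by (simp add: dconst_def shift_single)

lemma shift_zero [simp]: "shift n 0 = 0"
  unfolding shift_def by (rule map_key_zero[OF inj_mono_shift])

lemma shift_one [simp]: "shift n 1 = 1"
  using shift_dconst[of n 1] by (simp add: dconst_def)

lemma shift_add: "shift n (p + q) = shift n p + shift n q"
  unfolding shift_def by (rule map_key_plus[OF inj_mono_shift])

lemma shift_sum: "shift n (sum f I) = (\<Sum>i\<in>I. shift n (f i))"
  by (induction I rule: infinite_finite_induct) (auto simp: shift_add)

lemma dpoly_induct [case_names single add]:
  fixes p :: "'a \<Rightarrow>\<^sub>0 'b::comm_monoid_add"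
  assumes "\<And>x c. P (Poly_Mapping.single x c)" "\<And>p q. P p \<Longrightarrow> P q \<Longrightarrow> P (p + q)"
  shows "P p"
proof (induction p rule: update_induct)
  case const
  show ?case using assms(1)[of undefined 0] by simp
next
  case (update f a b)
  have "Poly_Mapping.update a b f = f + Poly_Mapping.single a b"
    using update(1)
    by (intro poly_mapping_eqI) (auto simp: lookup_update lookup_add lookup_single in_keys_iff when_def)
  then show ?case using assms update by simp
qed

lemma shift_mult: "shift n (p * q) = shift n p * shift n q"
proof (induction p rule: dpoly_induct)
  case (single x c)
  show ?case
    by (induction q rule: dpoly_induct)
       (simp_all add: shift_single mult_single mono_shift_plus shift_add distrib_left)
qed (simp add: shift_add distrib_right)

lemma shift_shift: "shift m (shift n p) = shift (m + n) p"
  by (induction p rule: dpoly_induct) (simp_all add: shift_single shift_add mono_shift_shift)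

lemma shift_0 [simp]: "shift 0 p = p"
  by (induction p rule: dpoly_induct) (simp_all add: shift_single shift_add)


section \<open>Pseudodifference operators\<close>

text \<open>
  \<open>pd_coeff P n\<close> is the coefficient (written on the left) of \<open>S\<^sup>n\<close>.
\<close>

typedef 'm psdo = "{f :: int \<Rightarrow> 'm dpoly. \<exists>b. \<forall>n>b. f n = 0}"
  morphisms pd_coeff Abs_psdo
  by (rule exI[of _ "\<lambda>_. 0"]) auto

setup_lifting type_definition_psdo

lemma psdo_eqI: "(\<And>n. pd_coeff P n = pd_coeff Q n) \<Longrightarrow> P = Q"
  by (metis ext pd_coeff_inject)

lemma pd_coeff_bound: "\<exists>b. \<forall>n>b. pd_coeff P n = 0"
  using pd_coeff[of P] by simp

definition twisted_prod :: "(int \<Rightarrow> 'm dpoly) \<Rightarrow> (int \<Rightarrow> 'm dpoly) \<Rightarrow> int \<Rightarrow> 'm dpoly" where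
  "twisted_prod f g n = (\<Sum>k | f k \<noteq> 0 \<and> g (n - k) \<noteq> 0. f k * shift k (g (n - k)))"

lemma twisted_prod_eq:
  assumes "\<And>k. k > a \<Longrightarrow> f k = 0" "\<And>k. k > b \<Longrightarrow> g k = 0" "A \<le> n - b" "a \<le> B"
  shows "twisted_prod f g n = (\<Sum>k\<in>{A..B}. f k * shift k (g (n - k)))"
  unfolding twisted_prod_def
proof (rule sum.mono_neutral_left)
  show "{k. f k \<noteq> 0 \<and> g (n - k) \<noteq> 0} \<subseteq> {A..B}"
  proof
    fix k assume "k \<in> {k. f k \<noteq> 0 \<and> g (n - k) \<noteq> 0}"
    then have "\<not> k > a" "\<not> n - k > b" using assms(1)[of k] assms(2)[of "n - k"] by auto
    then show "k \<in> {A..B}" using assms(3,4) by simp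
  qed
qed auto

lemma twisted_prod_bound:
  assumes "\<And>k. k > a \<Longrightarrow> f k = 0" "\<And>k. k > b \<Longrightarrow> g k = 0" "n > a + b"
  shows "twisted_prod f g n = 0"
  using twisted_prod_eq[of a f b g "n - b" n a] assms by simp

instantiation psdo :: (type) ring_1
begin

lift_definition zero_psdo :: "'a psdo" is "\<lambda>_. 0" by auto
lift_definition one_psdo :: "'a psdo" is "\<lambda>n. if n = 0 then 1 else 0" by (intro exI[of _ 0]) auto
lift_definition plus_psdo :: "'a psdo \<Rightarrow> 'a psdo \<Rightarrow> 'a psdo" is "\<lambda>f g n. f n + g n"
proof -
  fix f g :: "int \<Rightarrow> 'a dpoly"
  assume "\<exists>b. \<forall>n>b. f n = 0" "\<exists>b. \<forall>n>b. g n = 0"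
  then obtain a b where "\<forall>n>a. f n = 0" "\<forall>n>b. g n = 0" by auto
  then show "\<exists>b. \<forall>n>b. f n + g n = 0" by (intro exI[of _ "max a b"]) auto
qed
lift_definition uminus_psdo :: "'a psdo \<Rightarrow> 'a psdo" is "\<lambda>f n. - f n" by auto
lift_definition minus_psdo :: "'a psdo \<Rightarrow> 'a psdo \<Rightarrow> 'a psdo" is "\<lambda>f g n. f n - g n"
proof -
  fix f g :: "int \<Rightarrow> 'a dpoly"
  assume "\<exists>b. \<forall>n>b. f n = 0" "\<exists>b. \<forall>n>b. g n = 0"
  then obtain a b where "\<forall>n>a. f n = 0" "\<forall>n>b. g n = 0" by auto
  then show "\<exists>b. \<forall>n>b. f n - g n = 0" by (intro exI[of _ "max a b"]) auto
qed
lift_definition times_psdo :: "'a psdo \<Rightarrow> 'a psdo \<Rightarrow> 'a psdo" is twisted_prod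
proof -
  fix f g :: "int \<Rightarrow> 'a dpoly"
  assume "\<exists>b. \<forall>n>b. f n = 0" "\<exists>b. \<forall>n>b. g n = 0"
  then obtain a b where "\<forall>n>a. f n = 0" "\<forall>n>b. g n = 0" by auto
  then show "\<exists>b. \<forall>n>b. twisted_prod f g n = 0"
    by (intro exI[of _ "a + b"] allI impI twisted_prod_bound[of a f b g]) auto
qed

lemma pd_coeff_mult:
  assumes "\<And>k. k > a \<Longrightarrow> pd_coeff P k = 0" "\<And>k. k > b \<Longrightarrow> pd_coeff Q k = 0"
    "A \<le> n - b" "a \<le> B"
  shows "pd_coeff (P * Q) n = (\<Sum>k\<in>{A..B}. pd_coeff P k * shift k (pd_coeff Q (n - k)))"
  using twisted_prod_eq[of a "pd_coeff P" b "pd_coeff Q" A n B] assms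
  by (simp add: times_psdo.rep_eq)

instance
proof
  fix P Q R :: "'a psdo"
  obtain a where a: "\<And>k. k > a \<Longrightarrow> pd_coeff P k = 0" using pd_coeff_bound by blast
  obtain b where b: "\<And>k. k > b \<Longrightarrow> pd_coeff Q k = 0" using pd_coeff_bound by blast
  obtain c where c: "\<And>k. k > c \<Longrightarrow> pd_coeff R k = 0" using pd_coeff_bound by blast
  show "P + Q + R = P + (Q + R)" "P + Q = Q + P" "0 + P = P" "- P + P = 0" "P - Q = P + - Q"
    by (rule psdo_eqI, simp add: plus_psdo.rep_eq minus_psdo.rep_eq uminus_psdo.rep_eq
          zero_psdo.rep_eq ac_simps)+
  show "(0::'a psdo) \<noteq> 1" 
    by (metis one_psdo.rep_eq zero_psdo.rep_eq zero_neq_one)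
  show "1 * P = P"
  proof (rule psdo_eqI)
    fix n
    have "pd_coeff (1 * P) n
        = (\<Sum>k\<in>{min 0 (n - a)..0}. pd_coeff 1 k * shift k (pd_coeff P (n - k)))"
      by (rule pd_coeff_mult[of 0 _ a]) (use a in \<open>auto simp: one_psdo.rep_eq\<close>)
    also have "\<dots> = (\<Sum>k\<in>{0}. pd_coeff 1 k * shift k (pd_coeff P (n - k)))"
      by (rule sum.mono_neutral_right) (auto simp: one_psdo.rep_eq)
    finally show "pd_coeff (1 * P) n = pd_coeff P n" by (simp add: one_psdo.rep_eq)
  qed
  show "P * 1 = P"
  proof (rule psdo_eqI)
    fix n
    have "pd_coeff (P * 1) n
        = (\<Sum>k\<in>{n..max n a}. pd_coeff P k * shift k (pd_coeff 1 (n - k)))"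
      by (rule pd_coeff_mult[of a _ 0]) (use a in \<open>auto simp: one_psdo.rep_eq\<close>)
    also have "\<dots> = (\<Sum>k\<in>{n}. pd_coeff P k * shift k (pd_coeff 1 (n - k)))"
      by (rule sum.mono_neutral_right) (auto simp: one_psdo.rep_eq)
    finally show "pd_coeff (P * 1) n = pd_coeff P n" by (simp add: one_psdo.rep_eq)
  qed
  show "(P + Q) * R = P * R + Q * R"
  proof (rule psdo_eqI)
    fix n
    show "pd_coeff ((P + Q) * R) n = pd_coeff (P * R + Q * R) n"
      using pd_coeff_mult[of "max a b" "P + Q" c R "n - c" n "max a b"]
        pd_coeff_mult[of a P c R "n - c" n "max a b"]
        pd_coeff_mult[of b Q c R "n - c" n "max a b"] a b c
      by (simp add: plus_psdo.rep_eq distrib_right sum.distrib)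
  qed
  show "P * (Q + R) = P * Q + P * R"
  proof (rule psdo_eqI)
    fix n
    let ?A = "n - max b c"
    show "pd_coeff (P * (Q + R)) n = pd_coeff (P * Q + P * R) n"
      using pd_coeff_mult[of a P "max b c" "Q + R" ?A n a]
        pd_coeff_mult[of a P b Q ?A n a]
        pd_coeff_mult[of a P c R ?A n a] a b c
      by (simp add: plus_psdo.rep_eq distrib_left sum.distrib shift_add)
  qed
  show "P * Q * R = P * (Q * R)"
  proof (rule psdo_eqI)
    fix n
    let ?J = "{n - c..a + b}" and ?K = "{n - c - b..a}"
    let ?t = "\<lambda>k j. pd_coeff P k * shift k (pd_coeff Q (j - k)) * shift j (pd_coeff R (n - j))"
    have PQ: "pd_coeff (P * Q) j = 0" if "j > a + b" for j
      using pd_coeff_mult[of a P b Q "j - b" j a] a b that by simp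
    have QR: "pd_coeff (Q * R) j = 0" if "j > b + c" for j
      using pd_coeff_mult[of b Q c R "j - c" j b] b c that by simp
    have "pd_coeff (P * Q * R) n = (\<Sum>j\<in>?J. pd_coeff (P * Q) j * shift j (pd_coeff R (n - j)))"
      by (rule pd_coeff_mult[of "a + b" _ c]) (use PQ c in auto)
    also have "\<dots> = (\<Sum>j\<in>?J. \<Sum>k\<in>?K. ?t k j)"
    proof (rule sum.cong)
      fix j assume "j \<in> ?J"
      then have "pd_coeff (P * Q) j = (\<Sum>k\<in>?K. pd_coeff P k * shift k (pd_coeff Q (j - k)))"
        by (intro pd_coeff_mult[of a _ b]) (use a b in auto)
      then show "pd_coeff (P * Q) j * shift j (pd_coeff R (n - j)) = (\<Sum>k\<in>?K. ?t k j)"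
        by (simp add: sum_distrib_right)
    qed simp
    also have "\<dots> = (\<Sum>k\<in>?K. \<Sum>j\<in>?J. ?t k j)"
      by (rule sum.swap)
    also have "\<dots> = (\<Sum>k\<in>?K. pd_coeff P k * shift k (pd_coeff (Q * R) (n - k)))"
    proof (rule sum.cong)
      fix k assume k: "k \<in> ?K"
      have "pd_coeff (Q * R) (n - k)
          = (\<Sum>l\<in>{n - c - k..a + b - k}. pd_coeff Q l * shift l (pd_coeff R (n - k - l)))"
        by (rule pd_coeff_mult[of b _ c]) (use k b c in auto)
      also have "\<dots> = (\<Sum>j\<in>?J. pd_coeff Q (j - k) * shift (j - k) (pd_coeff R (n - j)))"
        by (rule sum.reindex_bij_witness[of _ "\<lambda>j. j - k" "\<lambda>l. l + k"])
           (auto simp: algebra_simps)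
      finally show "(\<Sum>j\<in>?J. ?t k j) = pd_coeff P k * shift k (pd_coeff (Q * R) (n - k))"
        by (simp add: shift_sum shift_mult shift_shift sum_distrib_left mult.assoc)
    qed simp
    also have "\<dots> = pd_coeff (P * (Q * R)) n"
      by (rule pd_coeff_mult[of a _ "b + c", symmetric]) (use a QR in auto)
    finally show "pd_coeff (P * Q * R) n = pd_coeff (P * (Q * R)) n" .
  qed
qed

end

definition monom_op :: "'m dpoly \<Rightarrow> int \<Rightarrow> 'm psdo" where
  "monom_op a n = Abs_psdo (\<lambda>k. if k = n then a else 0)"

lemma pd_coeff_monom_op: "pd_coeff (monom_op a n) k = (if k = n then a else 0)"
  unfolding monom_op_def by (subst Abs_psdo_inverse) (auto intro!: exI[of _ n])

lemma monom_op_mult: "monom_op a n * monom_op b m = monom_op (a * shift n b) (n + m)"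
proof (rule psdo_eqI)
  fix k
  have "pd_coeff (monom_op a n * monom_op b m) k = (\<Sum>i\<in>{min n (k - m)..n}.
      pd_coeff (monom_op a n) i * shift i (pd_coeff (monom_op b m) (k - i)))"
    by (rule pd_coeff_mult[of n _ m]) (auto simp: pd_coeff_monom_op)
  also have "\<dots> = (\<Sum>i\<in>{n}. pd_coeff (monom_op a n) i * shift i (pd_coeff (monom_op b m) (k - i)))"
    by (rule sum.mono_neutral_right) (auto simp: pd_coeff_monom_op)
  finally show "pd_coeff (monom_op a n * monom_op b m) k
      = pd_coeff (monom_op (a * shift n b) (n + m)) k"
    by (auto simp: pd_coeff_monom_op)
qed

definition pd_supp :: "'m psdo \<Rightarrow> int set" where
  "pd_supp P = {n. pd_coeff P n \<noteq> 0}"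

text \<open>The difference operators sit inside the pseudodifference operators.\<close>

definition is_diffop :: "'m psdo \<Rightarrow> bool" where
  "is_diffop P \<longleftrightarrow> finite (pd_supp P)"

lift_definition pos_part :: "'m psdo \<Rightarrow> 'm psdo" is "\<lambda>f n. if n \<ge> 0 then f n else 0"
  by auto

definition Res :: "'m psdo \<Rightarrow> 'm dpoly" where
  "Res P = pd_coeff P 0"

definition commutator :: "'m psdo \<Rightarrow> 'm psdo \<Rightarrow> 'm psdo" where
  "commutator P Q = P * Q - Q * P"

text \<open>
  Only meaningful for invertible operators; an operator whose leading coefficient is \<open>1\<close>
  is invertible, and negative powers are powers of the inverse.
\<close>

definition pd_inverse :: "'m psdo \<Rightarrow> 'm psdo" where
  "pd_inverse P = (THE Q. P * Q = 1 \<and> Q * P = 1)"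


section \<open>Lax flows\<close>

definition lax_op :: "nat \<Rightarrow> ('m::finite \<Rightarrow> nat) \<Rightarrow> 'm psdo" where
  "lax_op N Ns = monom_op 1 (- int N) + (\<Sum>i\<in>UNIV. monom_op (dvar i 0) (- int (Ns i)))"

text \<open>Derivations of the complex algebra of difference polynomials are complex linear.\<close>

definition is_derivation :: "('m dpoly \<Rightarrow> 'm dpoly) \<Rightarrow> bool" where
  "is_derivation D \<longleftrightarrow>
     (\<forall>f g. D (f + g) = D f + D g) \<and>
     (\<forall>c f. D (dconst c * f) = dconst c * D f) \<and>
     (\<forall>f g. D (f * g) = D f * g + f * D g)"

definition deriv_lax_op :: "('m::finite \<Rightarrow> nat) \<Rightarrow> ('m dpoly \<Rightarrow> 'm dpoly) \<Rightarrow> 'm psdo" where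
  "deriv_lax_op Ns D = (\<Sum>i\<in>UNIV. monom_op (D (dvar i 0)) (- int (Ns i)))"

definition lax_flow_by ::
    "nat \<Rightarrow> ('m::finite \<Rightarrow> nat) \<Rightarrow> 'm psdo \<Rightarrow> ('m dpoly \<Rightarrow> 'm dpoly) \<Rightarrow> bool" where
  "lax_flow_by N Ns A D \<longleftrightarrow>
     is_derivation D \<and> (\<forall>f. D (shift 1 f) = shift 1 (D f)) \<and>
     is_diffop A \<and> pd_supp (commutator A (lax_op N Ns)) \<subseteq> pd_supp (lax_op N Ns) \<and>
     deriv_lax_op Ns D = commutator A (lax_op N Ns)"

definition lax_flow :: "nat \<Rightarrow> ('m::finite \<Rightarrow> nat) \<Rightarrow> ('m dpoly \<Rightarrow> 'm dpoly) \<Rightarrow> bool" where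
  "lax_flow N Ns D \<longleftrightarrow> (\<exists>A. lax_flow_by N Ns A D)"

text \<open>
  The complex vector space structure on maps between difference polynomials, in which
  linear independence of flows is taken.
\<close>

definition scale_map :: "complex \<Rightarrow> ('m dpoly \<Rightarrow> 'm dpoly) \<Rightarrow> 'm dpoly \<Rightarrow> 'm dpoly" where
  "scale_map c D = (\<lambda>f. dconst c * D f)"

interpretation flows: vector_space "scale_map :: complex \<Rightarrow> ('m dpoly \<Rightarrow> 'm dpoly) \<Rightarrow> _"
proof
  fix a b :: complex and x y :: "'m dpoly \<Rightarrow> 'm dpoly"
  have dc: "dconst (a + b) = (dconst a + dconst b :: 'm dpoly)"
    "dconst (a * b) = (dconst a * dconst b :: 'm dpoly)" "dconst 1 = (1 :: 'm dpoly)"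
    by (simp_all add: dconst_def single_add mult_single)
  show "scale_map a (x + y) = scale_map a x + scale_map a y"
    by (rule ext) (simp add: scale_map_def distrib_left)
  show "scale_map (a + b) x = scale_map a x + scale_map b x"
    by (rule ext) (simp add: scale_map_def dc distrib_right)
  show "scale_map a (scale_map b x) = scale_map (a * b) x"
    by (rule ext) (simp add: scale_map_def dc mult.assoc)
  show "scale_map 1 x = x"
    by (rule ext) (simp add: scale_map_def dc)
qed

text \<open>
  The flows of a hierarchy are indexed by positive \<open>k\<close>; the value \<open>D 0\<close> is irrelevant.
\<close>

definition lax_hierarchy ::
    "nat \<Rightarrow> ('m::finite \<Rightarrow> nat) \<Rightarrow> nat \<Rightarrow> (nat \<Rightarrow> 'm dpoly \<Rightarrow> 'm dpoly) \<Rightarrow> bool" where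
  "lax_hierarchy N Ns q D \<longleftrightarrow>
     (\<forall>k>0. lax_flow_by N Ns (pos_part (pd_inverse (lax_op N Ns) ^ (q * k))) (D k)) \<and>
     (\<forall>k>0. \<forall>l>0. D k \<circ> D l = D l \<circ> D k)"

end

theory Submission
  imports Defs "HOL-Computational_Algebra.Polynomial"
begin

text \<open>
  \<^bold>\<open>Arithmetic support.\<close> Write \<open>N\<^sub>i = N + \<ell>\<^sub>i\<close>. The lowest coefficient of an auxiliary operator
  \<open>A\<close> of negative order is forced to be a multiple of that of a power of \<open>L\<close>, so the negative
  part of \<open>A\<close> commutes with \<open>L\<close> and may be dropped. The leading coefficient is then a constant,
  so flows with \<open>A\<close> of order at most \<open>d\<close> span a space of finite dimension, and infinitely many
  independent flows provide an \<open>A\<close> of arbitrarily large order \<open>d\<close>. The vanishing of the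
  coefficients of order above \<open>-N\<close> in \<open>[A, L]\<close> is a recursion for the coefficients of \<open>A\<close>.
  Evaluated at suitable points it has terms of one sign only, and it shows that the coefficient
  of \<open>S\<^sup>k\<close> depends on the variables of shift \<open>d\<close> if \<open>d - k\<close> is a nonzero element of the semigroup
  generated by the \<open>\<ell>\<^sub>i\<close>. By the same sign argument the coefficient of \<open>S\<^bsup>-N-s\<^esup>\<close> in \<open>[A, L]\<close> is
  nonzero whenever \<open>0 < s \<le> \<ell>\<^sub>M\<close> and \<open>p\<close> divides \<open>d + s\<close>, once \<open>d\<close> exceeds the conductor of the
  semigroup. So all these \<open>s\<close> are among the \<open>\<ell>\<^sub>i\<close>, hence multiples of \<open>p\<close>, and \<open>p\<close> divides \<open>d\<close>.

  \<^bold>\<open>Hierarchy.\<close> As \<open>L\<^bsup>-qk\<^esup>\<close> has its support in the multiples of \<open>p\<close> and commutes with \<open>L\<close>, its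
  nonnegative part defines a Lax flow. Commutativity is the zero curvature equation,
  conservation holds because residues of commutators are total differences, and the densities
  are distinguished by their binomial values at one shift-invariant point.
\<close>

section \<open>Evaluation homomorphisms\<close>

text \<open>The target ring stays general because two instances are used: complex values at a point,
  and polynomials over the difference polynomials, from which derivations are built.\<close>

locale coeff_hom =
  fixes h :: "complex \<Rightarrow> 'r::comm_ring_1"
  assumes h_add: "h (a + b) = h a + h b" and h_mult: "h (a * b) = h a * h b" and h_1: "h 1 = 1"
begin

lemma h_0: "h 0 = 0"
  using h_add[of 0 0] by simp

definition mono_eval :: "('x \<Rightarrow> 'r) \<Rightarrow> ('x \<Rightarrow>\<^sub>0 nat) \<Rightarrow> 'r" where
  "mono_eval v x = (\<Prod>y\<in>Poly_Mapping.keys x. v y ^ Poly_Mapping.lookup x y)"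

definition poly_eval :: "('x \<Rightarrow> 'r) \<Rightarrow> (('x \<Rightarrow>\<^sub>0 nat) \<Rightarrow>\<^sub>0 complex) \<Rightarrow> 'r" where
  "poly_eval v f = (\<Sum>x\<in>Poly_Mapping.keys f. h (Poly_Mapping.lookup f x) * mono_eval v x)"

lemma mono_eval_superset:
  assumes "finite A" "Poly_Mapping.keys x \<subseteq> A"
  shows "mono_eval v x = (\<Prod>y\<in>A. v y ^ Poly_Mapping.lookup x y)"
  unfolding mono_eval_def using assms by (intro prod.mono_neutral_left) (auto simp: in_keys_iff)

lemma poly_eval_superset:
  assumes "finite A" "Poly_Mapping.keys f \<subseteq> A"
  shows "poly_eval v f = (\<Sum>x\<in>A. h (Poly_Mapping.lookup f x) * mono_eval v x)"
  unfolding poly_eval_def using assms by (intro sum.mono_neutral_left) (auto simp: in_keys_iff h_0)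

lemma mono_eval_0 [simp]: "mono_eval v 0 = 1"
  by (simp add: mono_eval_def)

lemma mono_eval_add: "mono_eval v (x + y) = mono_eval v x * mono_eval v y"
proof -
  let ?A = "Poly_Mapping.keys x \<union> Poly_Mapping.keys y"
  have "Poly_Mapping.keys (x + y) \<subseteq> ?A"
    by (rule Poly_Mapping.keys_add)
  then show ?thesis
    using mono_eval_superset[of ?A "x + y" v] mono_eval_superset[of ?A x v]
      mono_eval_superset[of ?A y v]
    by (simp add: lookup_add power_add prod.distrib)
qed

lemma mono_eval_single [simp]: "mono_eval v (Poly_Mapping.single y n) = v y ^ n"
  by (cases "n = 0") (simp_all add: mono_eval_def)

lemma poly_eval_single: "poly_eval v (Poly_Mapping.single x c) = h c * mono_eval v x"
  by (cases "c = 0") (simp_all add: poly_eval_def h_0)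

lemma poly_eval_0 [simp]: "poly_eval v 0 = 0"
  by (simp add: poly_eval_def)

lemma poly_eval_add: "poly_eval v (f + g) = poly_eval v f + poly_eval v g"
proof -
  let ?A = "Poly_Mapping.keys f \<union> Poly_Mapping.keys g"
  have "Poly_Mapping.keys (f + g) \<subseteq> ?A"
    by (rule Poly_Mapping.keys_add)
  then show ?thesis
    using poly_eval_superset[of ?A "f + g" v] poly_eval_superset[of ?A f v]
      poly_eval_superset[of ?A g v]
    by (simp add: lookup_add h_add distrib_right sum.distrib)
qed

lemma poly_eval_uminus: "poly_eval v (- f) = - poly_eval v f"
  using poly_eval_add[of v f "- f"] by (simp add: add_eq_0_iff)

lemma poly_eval_diff: "poly_eval v (f - g) = poly_eval v f - poly_eval v g"
  using poly_eval_add[of v f "- g"] by (simp add: poly_eval_uminus)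

lemma poly_eval_sum: "poly_eval v (sum f I) = (\<Sum>i\<in>I. poly_eval v (f i))"
  by (induction I rule: infinite_finite_induct) (simp_all add: poly_eval_add)

lemma poly_eval_mult: "poly_eval v (f * g) = poly_eval v f * poly_eval v g"
proof (induction f rule: dpoly_induct)
  case (single x c)
  show ?case
    by (induction g rule: dpoly_induct)
       (simp_all add: poly_eval_single mult_single mono_eval_add h_mult poly_eval_add algebra_simps)
qed (simp add: poly_eval_add distrib_right)

lemma poly_eval_dvar: "poly_eval v (dvar i j) = v (i, j)"
  by (simp add: dvar_def poly_eval_single h_1)

lemma poly_eval_dconst: "poly_eval v (dconst c) = h c"
  by (simp add: dconst_def poly_eval_single)

lemma poly_eval_1: "poly_eval v 1 = 1"
  using poly_eval_single[of v 0 1] by (simp add: h_1)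

lemma poly_eval_cong:
  assumes "\<And>x y. x \<in> Poly_Mapping.keys f \<Longrightarrow> y \<in> Poly_Mapping.keys x \<Longrightarrow> v y = w y"
  shows "poly_eval v f = poly_eval w f"
  unfolding poly_eval_def mono_eval_def using assms by (intro sum.cong prod.cong) auto

end

interpretation cx: coeff_hom "\<lambda>c. c"
  by standard auto

lemma dconst_add: "dconst (a + b) = dconst a + dconst b"
  by (simp add: dconst_def single_add)

lemma dconst_mult: "dconst (a * b) = dconst a * dconst b"
  by (simp add: dconst_def mult_single)

lemma dconst_1 [simp]: "dconst 1 = 1"
  by (simp add: dconst_def)

lemma dconst_0 [simp]: "dconst 0 = 0"
  by (simp add: dconst_def)

lemma dvar_power: "dvar i j ^ e = Poly_Mapping.single (Poly_Mapping.single (i, j) e) 1"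
proof (induction e)
  case (Suc e)
  have "Poly_Mapping.single (Poly_Mapping.single (i, j) (Suc e)) (1::complex)
      = dvar i j * Poly_Mapping.single (Poly_Mapping.single (i, j) e) 1"
    by (simp add: dvar_def mult_single flip: single_add)
  then show ?case using Suc by simp
qed simp

lemma shift_uminus: "shift n (- f) = - shift n f"
  using shift_add[of n f "- f"] by (simp add: add_eq_0_iff)

lemma shift_diff: "shift n (f - g) = shift n f - shift n g"
  using shift_add[of n f "- g"] by (simp add: shift_uminus)

lemma shift_eq_iff [simp]: "shift n f = shift n g \<longleftrightarrow> f = g"
  by (metis add.left_inverse shift_0 shift_shift)


section \<open>Derivations\<close>

lemma derivation_add: "is_derivation D \<Longrightarrow> D (f + g) = D f + D g"
  by (simp add: is_derivation_def)

lemma derivation_dconst_mult: "is_derivation D \<Longrightarrow> D (dconst c * f) = dconst c * D f"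
  unfolding is_derivation_def by blast

lemma derivation_mult: "is_derivation D \<Longrightarrow> D (f * g) = D f * g + f * D g"
  unfolding is_derivation_def by blast

lemma derivation_0: "is_derivation D \<Longrightarrow> D 0 = 0"
  using derivation_add[of D 0 0] by simp

lemma derivation_uminus: "is_derivation D \<Longrightarrow> D (- f) = - D f"
  using derivation_add[of D f "- f"] by (simp add: derivation_0 add_eq_0_iff)

lemma derivation_diff: "is_derivation D \<Longrightarrow> D (f - g) = D f - D g"
  using derivation_add[of D f "- g"] by (simp add: derivation_uminus)

lemma derivation_1: "is_derivation D \<Longrightarrow> D 1 = 0"
  using derivation_mult[of D 1 1] by simp

lemma derivation_sum: "is_derivation D \<Longrightarrow> D (sum f I) = (\<Sum>i\<in>I. D (f i))"
  by (induction I rule: infinite_finite_induct) (simp_all add: derivation_0 derivation_add)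

lemma derivation_shift:
  assumes "\<And>f. D (shift 1 f) = shift 1 (D f)"
  shows "D (shift n f) = shift n (D f)"
proof (induction n arbitrary: f rule: int_induct[where k = 0])
  case (step1 i)
  then show ?case using assms by (metis shift_shift)
next
  case (step2 i)
  have "shift 1 (D (shift (i - 1) f)) = shift i (D f)"
    by (simp flip: assms add: shift_shift step2)
  then show ?case
    by (metis (no_types, opaque_lifting) add.commute diff_add_cancel shift_shift shift_eq_iff)
qed simp

text \<open>Commutation with the shift carries the zeros from the generators to all variables; the
  Leibniz rule then reaches all monomials. Uniqueness and commutativity of flows both reduce to
  this.\<close>

lemma derivation_zeroI:
  assumes D: "is_derivation D" and s: "\<And>f. D (shift 1 f) = shift 1 (D f)"
    and z: "\<And>i. D (dvar i 0) = 0"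
  shows "D f = 0"
proof -
  have v: "D (dvar i j) = 0" for i j
    using derivation_shift[of D j "dvar i 0", OF s] z[of i] by (simp add: shift_dvar)
  have pow: "D (a ^ n) = 0" if "D a = 0" for a n
    using that by (induction n) (simp_all add: derivation_1[OF D] derivation_mult[OF D])
  have m: "D (Poly_Mapping.single x 1) = 0" for x
  proof (induction x rule: dpoly_induct)
    case (single y e)
    obtain i j where y: "y = (i, j)" by (cases y)
    show ?case by (simp add: pow v y flip: dvar_power)
  next
    case (add x y)
    have "Poly_Mapping.single (x + y) (1::complex)
        = Poly_Mapping.single x 1 * Poly_Mapping.single y 1"
      by (simp add: mult_single)
    then show ?case using add by (simp add: derivation_mult[OF D])
  qed
  show ?thesis
  proof (induction f rule: dpoly_induct)
    case (single x c)
    have "Poly_Mapping.single x c = dconst c * Poly_Mapping.single x 1"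
      by (simp add: dconst_def mult_single)
    then show ?case by (simp add: derivation_dconst_mult[OF D] m)
  qed (simp add: derivation_add[OF D])
qed

text \<open>
  A derivation is the first-order part of an algebra homomorphism \<open>f \<mapsto> f + D f X\<close> into the
  polynomial ring over the difference polynomials modulo \<open>X\<^sup>2\<close>.
\<close>

interpretation dual: coeff_hom "\<lambda>c. [:dconst c:] :: 'm dpoly poly"
  by standard (auto simp: dconst_add dconst_mult one_pCons)

lemma derivation_exists:
  fixes g :: "'m \<Rightarrow> 'm dpoly"
  obtains D where "is_derivation D" "\<And>f. D (shift 1 f) = shift 1 (D f)" "\<And>i. D (dvar i 0) = g i"
proof -
  \<comment> \<open>The linear coefficient \<open>shift j (g i)\<close> is the value that
    commutation with the shift forces on \<open>dvar i j\<close>.\<close>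
  define v where "v = (\<lambda>(i, j). [:dvar i j, shift j (g i):])"
  define E where "E = dual.poly_eval v"
  define D where "D f = coeff (E f) (Suc 0)" for f
  \<comment> \<open>The first two coefficients of a product depend only on those of the factors, so
    the quotient by \<open>X^2\<close> need not be formed.\<close>
  have coeff_mult: "coeff (a * b) 0 = coeff a 0 * coeff b 0"
    "coeff (a * b) (Suc 0) = coeff a (Suc 0) * coeff b 0 + coeff a 0 * coeff b (Suc 0)" for a b :: "'m dpoly poly"
    by (simp_all add: coeff_mult mult.commute add.commute)
  have pw: "coeff (a ^ n) 0 = coeff a 0 ^ n" for a :: "'m dpoly poly" and n
    by (induction n) (simp_all add: coeff_mult)
  have mono0: "coeff (dual.mono_eval v x) 0 = Poly_Mapping.single x 1" for x
  proof (induction x rule: dpoly_induct)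
    case (single y e)
    obtain i j where y: "y = (i, j)" by (cases y)
    show ?case by (simp add: pw v_def y flip: dvar_power)
  qed (simp add: dual.mono_eval_add coeff_mult mult_single)
  have E0: "coeff (E f) 0 = f" for f
  proof (induction f rule: dpoly_induct)
    case (single x c)
    have "dconst c * Poly_Mapping.single x 1 = Poly_Mapping.single x c"
      by (simp add: dconst_def mult_single)
    then show ?case by (simp add: E_def dual.poly_eval_single mono0)
  qed (simp add: E_def dual.poly_eval_add)
  have D: "is_derivation D"
    unfolding is_derivation_def D_def
    by (auto simp: E_def dual.poly_eval_add dual.poly_eval_mult coeff_mult dual.poly_eval_dconst
          E0[unfolded E_def])
  have Dv: "D (dvar i j) = shift j (g i)" for i j
    by (simp add: D_def E_def dual.poly_eval_dvar v_def)
  have Dpow: "D (shift 1 (a ^ n)) = shift 1 (D (a ^ n))" if "D (shift 1 a) = shift 1 (D a)" for a n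
    using that
    by (induction n) (simp_all add: derivation_1[OF D] derivation_mult[OF D] shift_add shift_mult)
  have m: "D (shift 1 (Poly_Mapping.single x 1)) = shift 1 (D (Poly_Mapping.single x 1))" for x
  proof (induction x rule: dpoly_induct)
    case (single y e)
    obtain i j where y: "y = (i, j)" by (cases y)
    show ?case by (simp add: y Dpow Dv shift_dvar shift_shift add.commute flip: dvar_power)
  next
    case (add x y)
    have "Poly_Mapping.single (x + y) (1::complex)
        = Poly_Mapping.single x 1 * Poly_Mapping.single y 1"
      by (simp add: mult_single)
    then show ?case using add by (simp add: derivation_mult[OF D] shift_mult shift_add)
  qed
  have "D (shift 1 f) = shift 1 (D f)" for f
  proof (induction f rule: dpoly_induct)
    case (single x c)
    have "Poly_Mapping.single x c = dconst c * Poly_Mapping.single x 1"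
      by (simp add: dconst_def mult_single)
    then show ?case by (simp add: derivation_dconst_mult[OF D] m shift_mult shift_dconst)
  qed (simp add: derivation_add[OF D] shift_add)
  with D that[of D] Dv show thesis by simp
qed


section \<open>Coefficients of pseudodifference operators\<close>

lemmas pd_coeff_simps [simp] = zero_psdo.rep_eq one_psdo.rep_eq plus_psdo.rep_eq minus_psdo.rep_eq
  uminus_psdo.rep_eq pos_part.rep_eq pd_coeff_monom_op

lemma pd_coeff_sum: "pd_coeff (sum f I) n = (\<Sum>i\<in>I. pd_coeff (f i) n)"
  by (induction I rule: infinite_finite_induct) simp_all

lemma pd_coeff_mult_monom_op: "pd_coeff (P * monom_op a n) k = pd_coeff P (k - n) * shift (k - n) a"
proof -
  obtain b where b: "\<And>k. k > b \<Longrightarrow> pd_coeff P k = 0" using pd_coeff_bound by blast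
  have "pd_coeff (P * monom_op a n) k = (\<Sum>i\<in>{k - n..max b (k - n)}.
      pd_coeff P i * shift i (pd_coeff (monom_op a n) (k - i)))"
    by (rule pd_coeff_mult[of b _ n]) (use b in auto)
  also have "\<dots> = (\<Sum>i\<in>{k - n}. pd_coeff P i * shift i (pd_coeff (monom_op a n) (k - i)))"
    by (rule sum.mono_neutral_right) auto
  finally show ?thesis by simp
qed

lemma pd_coeff_monom_op_mult: "pd_coeff (monom_op a n * P) k = a * shift n (pd_coeff P (k - n))"
proof -
  obtain b where b: "\<And>k. k > b \<Longrightarrow> pd_coeff P k = 0" using pd_coeff_bound by blast
  have "pd_coeff (monom_op a n * P) k = (\<Sum>i\<in>{min n (k - b)..n}.
      pd_coeff (monom_op a n) i * shift i (pd_coeff P (k - i)))"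
    by (rule pd_coeff_mult[of n _ b]) (use b in auto)
  also have "\<dots> = (\<Sum>i\<in>{n}. pd_coeff (monom_op a n) i * shift i (pd_coeff P (k - i)))"
    by (rule sum.mono_neutral_right) auto
  finally show ?thesis by simp
qed

lemma pd_coeff_mult_above:
  assumes "\<And>k. k > a \<Longrightarrow> pd_coeff P k = 0" "\<And>k. k > b \<Longrightarrow> pd_coeff Q k = 0" "n > a + b"
  shows "pd_coeff (P * Q) n = 0"
  using pd_coeff_mult[of a P b Q "n - b" n a] assms by simp

lemma pd_coeff_mult_nonzero:
  assumes "pd_coeff (P * Q) n \<noteq> 0"
  obtains k where "pd_coeff P k \<noteq> 0" "pd_coeff Q (n - k) \<noteq> 0"
proof (rule ccontr)
  assume "\<not> thesis"
  then have "{k. pd_coeff P k \<noteq> 0 \<and> pd_coeff Q (n - k) \<noteq> 0} = {}"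
    using that by blast
  then have "pd_coeff (P * Q) n = 0"
    unfolding times_psdo.rep_eq twisted_prod_def by (simp only: sum.empty)
  with assms show False by simp
qed

lemma monom_op_1_0 [simp]: "monom_op 1 0 = 1"
  by (rule psdo_eqI) simp

lemma dconst_op_central: "monom_op (dconst c) 0 * P = P * monom_op (dconst c) 0"
  by (rule psdo_eqI) (simp add: pd_coeff_mult_monom_op pd_coeff_monom_op_mult shift_dconst mult.commute)

text \<open>The type already bounds supports from above, so finiteness amounts to a bound from
  below.\<close>

lemma is_diffop_iff: "is_diffop P \<longleftrightarrow> (\<exists>b. \<forall>k<b. pd_coeff P k = 0)"
proof
  assume "is_diffop P"
  then have fin: "finite (pd_supp P)" by (simp add: is_diffop_def)
  show "\<exists>b. \<forall>k<b. pd_coeff P k = 0"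
  proof (cases "pd_supp P = {}")
    case False
    then show ?thesis
      using Min_le[OF fin] by (intro exI[of _ "Min (pd_supp P)"]) (force simp: pd_supp_def)
  qed (auto simp: pd_supp_def)
next
  assume "\<exists>b. \<forall>k<b. pd_coeff P k = 0"
  then obtain b where b: "\<And>k. k < b \<Longrightarrow> pd_coeff P k = 0" by blast
  obtain a where a: "\<And>k. k > a \<Longrightarrow> pd_coeff P k = 0" using pd_coeff_bound by blast
  have "pd_supp P \<subseteq> {b..a}"
    using a b by (force simp: pd_supp_def not_less[symmetric])
  then show "is_diffop P"
    by (simp add: is_diffop_def finite_subset)
qed

lemma is_diffop_pos_part: "is_diffop (pos_part P)"
  unfolding is_diffop_iff by (rule exI[of _ 0]) simp


section \<open>Inverses of monic operators\<close>

text \<open>Solves \<open>P * Q = 1\<close> order by order for \<open>P\<close> with leading term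
  \<open>S^a\<close>: the value at \<open>j\<close> is the coefficient of \<open>S^(-a-j)\<close> in
  \<open>Q\<close>. The outer shift undoes the action of the leading term.\<close>

fun rinv_coeff :: "(int \<Rightarrow> 'm dpoly) \<Rightarrow> int \<Rightarrow> nat \<Rightarrow> 'm dpoly" where
  "rinv_coeff f a j = shift (- a)
     ((if j = 0 then 1 else 0) - (\<Sum>i\<in>{1..j}. f (a - int i) * shift (a - int i) (rinv_coeff f a (j - i))))"

declare rinv_coeff.simps [simp del]

lemma monic_right_inverse:
  fixes P :: "'m psdo"
  assumes top: "pd_coeff P a = 1" and above: "\<And>k. k > a \<Longrightarrow> pd_coeff P k = 0"
  obtains Q where "P * Q = 1" "pd_coeff Q (- a) = 1" "\<And>k. k > - a \<Longrightarrow> pd_coeff Q k = 0"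
proof -
  let ?r = "rinv_coeff (pd_coeff P) a"
  define g where "g = (\<lambda>n. if n > - a then 0 else ?r (nat (- a - n)))"
  define Q where "Q = Abs_psdo g"
  have Q: "pd_coeff Q = g"
    unfolding Q_def g_def by (subst Abs_psdo_inverse) (auto intro!: exI[of _ "- a"])
  have "pd_coeff (P * Q) n = (if n = 0 then 1 else 0)" for n
  proof (cases "n > 0")
    case True
    then show ?thesis
      using pd_coeff_mult_above[of a P "- a" Q n] above by (simp add: Q g_def)
  next
    case False
    define j where "j = nat (- n)"
    have n: "n = - int j" using False by (simp add: j_def)
    have "pd_coeff (P * Q) n
        = (\<Sum>k\<in>{a - int j..a}. pd_coeff P k * shift k (pd_coeff Q (n - k)))"
      by (rule pd_coeff_mult[of a _ "- a"]) (use above in \<open>auto simp: Q g_def n\<close>)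
    also have "\<dots> = (\<Sum>i\<in>{0..j}. pd_coeff P (a - int i) * shift (a - int i) (?r (j - i)))"
    proof (rule sum.reindex_bij_witness[of _ "\<lambda>i. a - int i" "\<lambda>k. nat (a - k)"])
      fix k assume k: "k \<in> {a - int j..a}"
      then have "nat (- a - (n - k)) = j - nat (a - k)"
        unfolding n atLeastAtMost_iff by arith
      then show "pd_coeff P (a - int (nat (a - k))) * shift (a - int (nat (a - k))) (?r (j - nat (a - k)))
          = pd_coeff P k * shift k (pd_coeff Q (n - k))"
        using k by (simp add: Q g_def n)
    qed auto
    also have "\<dots> = shift a (?r j)
        + (\<Sum>i\<in>{1..j}. pd_coeff P (a - int i) * shift (a - int i) (?r (j - i)))"
      by (simp add: sum.atLeast_Suc_atMost top)
    also have "\<dots> = (if j = 0 then 1 else 0)"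
      by (subst rinv_coeff.simps) (simp add: shift_shift)
    finally show ?thesis by (simp add: n)
  qed
  then have "P * Q = 1" by (intro psdo_eqI) simp
  moreover have "pd_coeff Q (- a) = 1"
    unfolding Q g_def by (subst rinv_coeff.simps) (simp add: shift_shift)
  moreover have "pd_coeff Q k = 0" if "k > - a" for k
    using that by (simp add: Q g_def)
  ultimately show thesis by (rule that)
qed

text \<open>The right inverse \<open>Q\<close> is again monic, so it has a right inverse
  \<open>R\<close>, and associativity gives \<open>R = P\<close>. Two-sided inverses are unique,
  hence the definite description denotes \<open>Q\<close>.\<close>

lemma monic_pd_inverse:
  fixes P :: "'m psdo"
  assumes top: "pd_coeff P a = 1" and above: "\<And>k. k > a \<Longrightarrow> pd_coeff P k = 0"
  shows "P * pd_inverse P = 1" "pd_inverse P * P = 1"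
proof -
  obtain Q where Q: "P * Q = 1" "pd_coeff Q (- a) = 1" "\<And>k. k > - a \<Longrightarrow> pd_coeff Q k = 0"
    using monic_right_inverse[OF assms] by blast
  obtain R where R: "Q * R = 1"
    using monic_right_inverse[OF Q(2,3)] by blast
  have "R = (P * Q) * R" by (simp add: Q(1))
  also have "\<dots> = P" by (simp only: mult.assoc R mult_1_right)
  finally have QP: "Q * P = 1" using R by simp
  have "pd_inverse P = Q"
    unfolding pd_inverse_def
  proof (rule the_equality)
    fix Q' assume "P * Q' = 1 \<and> Q' * P = 1"
    then show "Q' = Q" by (metis Q(1) mult.assoc mult_1_left mult_1_right)
  qed (simp add: Q(1) QP)
  then show "P * pd_inverse P = 1" "pd_inverse P * P = 1"
    by (simp_all add: Q(1) QP)
qed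


section \<open>Derivations of pseudodifference operators\<close>

lemma commutator_diff_left: "commutator (P - Q) R = commutator P R - commutator Q R"
  by (simp add: commutator_def algebra_simps)

text \<open>The coefficientwise image is bounded above when \<open>D 0 = 0\<close>; the facts about
  it therefore assume a derivation.\<close>

definition pd_map :: "('m dpoly \<Rightarrow> 'm dpoly) \<Rightarrow> 'm psdo \<Rightarrow> 'm psdo" where
  "pd_map D P = Abs_psdo (\<lambda>n. D (pd_coeff P n))"

lemma pd_coeff_pd_map: "is_derivation D \<Longrightarrow> pd_coeff (pd_map D P) n = D (pd_coeff P n)"
  unfolding pd_map_def using pd_coeff_bound[of P]
  by (subst Abs_psdo_inverse) (simp, metis derivation_0, simp)

lemma pd_map_diff: "is_derivation D \<Longrightarrow> pd_map D (P - Q) = pd_map D P - pd_map D Q"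
  by (rule psdo_eqI) (simp add: pd_coeff_pd_map derivation_diff)

lemma pd_map_1: "is_derivation D \<Longrightarrow> pd_map D 1 = 0"
  by (rule psdo_eqI) (simp add: pd_coeff_pd_map derivation_0 derivation_1)

lemma pd_map_pos_part: "is_derivation D \<Longrightarrow> pd_map D (pos_part P) = pos_part (pd_map D P)"
  by (rule psdo_eqI) (simp add: pd_coeff_pd_map derivation_0)

text \<open>The product twists right-hand coefficients by shifts, so the Leibniz rule for operators
  rests on \<open>D\<close> commuting with them.\<close>

lemma pd_map_mult:
  fixes P Q :: "'m psdo"
  assumes D: "is_derivation D" and s: "\<And>f. D (shift 1 f) = shift 1 (D f)"
  shows "pd_map D (P * Q) = pd_map D P * Q + P * pd_map D Q"
proof (rule psdo_eqI)
  fix n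
  obtain a where a: "\<And>k. k > a \<Longrightarrow> pd_coeff P k = 0" using pd_coeff_bound by blast
  obtain b where b: "\<And>k. k > b \<Longrightarrow> pd_coeff Q k = 0" using pd_coeff_bound by blast
  let ?S = "\<lambda>f g. \<Sum>k\<in>{n - b..a}. f k * shift k (g (n - k) :: 'm dpoly)"
  have "pd_coeff (P * Q) n = ?S (pd_coeff P) (pd_coeff Q)"
    by (rule pd_coeff_mult) (use a b in auto)
  moreover have "pd_coeff (pd_map D P * Q) n = ?S (\<lambda>k. D (pd_coeff P k)) (pd_coeff Q)"
    unfolding pd_coeff_pd_map[OF D, symmetric]
    by (rule pd_coeff_mult) (use a b in \<open>auto simp: pd_coeff_pd_map[OF D] derivation_0[OF D]\<close>)
  moreover have "pd_coeff (P * pd_map D Q) n = ?S (pd_coeff P) (\<lambda>k. D (pd_coeff Q k))"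
    unfolding pd_coeff_pd_map[OF D, symmetric]
    by (rule pd_coeff_mult) (use a b in \<open>auto simp: pd_coeff_pd_map[OF D] derivation_0[OF D]\<close>)
  ultimately show "pd_coeff (pd_map D (P * Q)) n = pd_coeff (pd_map D P * Q + P * pd_map D Q) n"
    by (simp add: pd_coeff_pd_map[OF D] derivation_sum[OF D] derivation_mult[OF D]
        derivation_shift[of D, OF s] sum.distrib)
qed

text \<open>Telescoping: \<open>S^n - 1\<close> is a multiple of \<open>S - 1\<close>, for negative
  \<open>n\<close> too.\<close>

lemma shift_minus_id_range: "\<exists>g. shift n f - f = shift 1 g - g"
proof (induction n rule: int_induct[where k = 0])
  case base
  show ?case by (rule exI[of _ 0]) simp
next
  case (step1 i)
  then obtain g where g: "shift 1 g - g = shift i f - f" by metis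
  have "shift 1 (shift i f + g) - (shift i f + g) = shift (i + 1) f - shift i f + (shift 1 g - g)"
    by (simp add: shift_add shift_shift add.commute)
  then have "shift (i + 1) f - f = shift 1 (shift i f + g) - (shift i f + g)"
    by (simp add: g)
  then show ?case by blast
next
  case (step2 i)
  then obtain g where g: "shift 1 g - g = shift i f - f" by metis
  have "shift 1 (g - shift (i - 1) f) - (g - shift (i - 1) f)
      = (shift 1 g - g) + shift (i - 1) f - shift i f"
    by (simp add: shift_diff shift_shift)
  then have "shift (i - 1) f - f = shift 1 (g - shift (i - 1) f) - (g - shift (i - 1) f)"
    by (simp add: g)
  then show ?case by blast
qed

text \<open>The terms of the two products pair up: with \<open>g = b_(-k) S^(-k)(a_k)\<close> the
  pair for \<open>k\<close> is \<open>S^k(g) - g\<close>, a total difference.\<close>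

lemma Res_commutator_range:
  fixes A P :: "'m psdo"
  assumes "is_diffop A"
  shows "Res (commutator A P) \<in> range (\<lambda>f :: 'm dpoly. shift 1 f - f)"
proof -
  let ?a = "pd_coeff A" and ?b = "pd_coeff P"
  obtain a b where a: "\<And>k. k > a \<Longrightarrow> ?a k = 0" and b: "\<And>k. k > b \<Longrightarrow> ?b k = 0"
    using pd_coeff_bound[of A] pd_coeff_bound[of P] by blast
  obtain c where c: "\<And>k. k < c \<Longrightarrow> ?a k = 0"
    using assms unfolding is_diffop_iff by blast
  define l where "l = min c (- b)"
  have "pd_coeff (A * P) 0 = (\<Sum>k\<in>{l..a}. ?a k * shift k (?b (- k)))"
    using pd_coeff_mult[of a A b P l 0 a] a b by (simp add: l_def)
  moreover have "pd_coeff (P * A) 0 = (\<Sum>k\<in>{l..a}. ?b (- k) * shift (- k) (?a k))"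
  proof -
    have "pd_coeff (P * A) 0 = (\<Sum>k\<in>{-a..-l}. ?b k * shift k (?a (0 - k)))"
      by (rule pd_coeff_mult[of b _ a]) (use a b in \<open>auto simp: l_def\<close>)
    also have "\<dots> = (\<Sum>k\<in>{l..a}. ?b (- k) * shift (- k) (?a k))"
      by (rule sum.reindex_bij_witness[of _ uminus uminus]) auto
    finally show ?thesis .
  qed
  ultimately have "Res (commutator A P)
      = (\<Sum>k\<in>{l..a}. ?a k * shift k (?b (- k)) - ?b (- k) * shift (- k) (?a k))"
    by (simp add: Res_def commutator_def sum_subtractf)
  also have "\<dots> = (\<Sum>k\<in>{l..a}. shift k (?b (- k) * shift (- k) (?a k)) - ?b (- k) * shift (- k) (?a k))"
    by (simp add: shift_mult shift_shift mult.commute)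
  also have "\<forall>k. \<exists>g. shift k (?b (- k) * shift (- k) (?a k)) - ?b (- k) * shift (- k) (?a k)
      = shift 1 g - g"
    by (intro allI shift_minus_id_range)
  then obtain g where "\<And>k. shift k (?b (- k) * shift (- k) (?a k)) - ?b (- k) * shift (- k) (?a k)
      = shift 1 (g k) - g k"
    by metis
  then have "(\<Sum>k\<in>{l..a}. shift k (?b (- k) * shift (- k) (?a k)) - ?b (- k) * shift (- k) (?a k))
      = shift 1 (\<Sum>k\<in>{l..a}. g k) - (\<Sum>k\<in>{l..a}. g k)"
    by (simp add: shift_sum sum_subtractf)
  finally show ?thesis by blast
qed


section \<open>Shift-invariant difference polynomials\<close>

text \<open>Serves as a degree that negative shifts lower; constants satisfy it for every
  \<open>J\<close>.\<close>

definition vars_le :: "int \<Rightarrow> 'm dpoly \<Rightarrow> bool" where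
  "vars_le J f \<longleftrightarrow> (\<forall>x\<in>Poly_Mapping.keys f. \<forall>(i, j)\<in>Poly_Mapping.keys x. j \<le> J)"

lemma vars_le_mono: "vars_le J f \<Longrightarrow> J \<le> K \<Longrightarrow> vars_le K f"
  unfolding vars_le_def by fastforce

lemma vars_le_0 [simp]: "vars_le J 0"
  by (simp add: vars_le_def)

lemma vars_le_dconst [simp]: "vars_le J (dconst c)"
  by (auto simp: vars_le_def dconst_def)

lemma vars_le_dvar: "j \<le> J \<Longrightarrow> vars_le J (dvar i j)"
  by (auto simp: vars_le_def dvar_def)

lemma vars_le_add: "vars_le J f \<Longrightarrow> vars_le J g \<Longrightarrow> vars_le J (f + g)"
  unfolding vars_le_def using Poly_Mapping.keys_add[of f g] by blast

lemma vars_le_uminus: "vars_le J (- f) \<longleftrightarrow> vars_le J f"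
  by (simp add: vars_le_def Poly_Mapping.keys_def lookup_uminus)

lemma vars_le_diff: "vars_le J f \<Longrightarrow> vars_le J g \<Longrightarrow> vars_le J (f - g)"
  using vars_le_add[of J f "- g"] by (simp add: vars_le_uminus)

lemma vars_le_sum: "(\<And>i. i \<in> I \<Longrightarrow> vars_le J (f i)) \<Longrightarrow> vars_le J (sum f I)"
  by (induction I rule: infinite_finite_induct) (simp_all add: vars_le_add)

lemma vars_le_mult:
  assumes "vars_le J f" "vars_le J g"
  shows "vars_le J (f * g)"
  unfolding vars_le_def
proof
  fix x assume "x \<in> Poly_Mapping.keys (f * g)"
  then obtain a b where "x = a + b" "a \<in> Poly_Mapping.keys f" "b \<in> Poly_Mapping.keys g"
    using Poly_Mapping.keys_mult[of f g] by blast
  then show "\<forall>(i, j)\<in>Poly_Mapping.keys x. j \<le> J"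
    using assms Poly_Mapping.keys_add[of a b] unfolding vars_le_def by blast
qed

lemma keys_mono_shift:
  "Poly_Mapping.keys (mono_shift n x) = (\<lambda>(i, j). (i, j + n)) ` Poly_Mapping.keys x"
proof -
  have "(\<lambda>(i, j). (i, j - n)) -` K = (\<lambda>(i, j). (i, j + n)) ` K" for K :: "('a \<times> int) set"
    by (force simp: image_iff)
  then show ?thesis
    unfolding mono_shift_def keys_map_key[OF inj_index_shift] by simp
qed

lemma keys_shift: "Poly_Mapping.keys (shift n f) = mono_shift n ` Poly_Mapping.keys f"
proof -
  have "mono_shift (- n) -` K = mono_shift n ` K" for K :: "('a \<times> int \<Rightarrow>\<^sub>0 nat) set"
    by (force simp: image_iff mono_shift_shift intro: bexI[of _ "mono_shift (- n) x" for x])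
  then show ?thesis
    unfolding shift_def keys_map_key[OF inj_mono_shift] by simp
qed

lemma vars_le_shift [simp]: "vars_le J (shift n f) \<longleftrightarrow> vars_le (J - n) f"
proof -
  have "(\<forall>(i, j)\<in>Poly_Mapping.keys (mono_shift n x). j \<le> J)
      \<longleftrightarrow> (\<forall>(i, j)\<in>Poly_Mapping.keys x. j \<le> J - n)" for x :: "'a \<times> int \<Rightarrow>\<^sub>0 nat"
    by (auto simp: keys_mono_shift le_diff_eq)
  then show ?thesis
    unfolding vars_le_def keys_shift by simp
qed

lemma vars_le_exists: "\<exists>J. vars_le J f"
proof (induction f rule: dpoly_induct)
  case (single x c)
  have "j \<le> Max (snd ` Poly_Mapping.keys x)" if "(i, j) \<in> Poly_Mapping.keys x" for i j
    using that by (intro Max_ge) force+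
  then have "vars_le (Max (snd ` Poly_Mapping.keys x)) (Poly_Mapping.single x c)"
    by (auto simp: vars_le_def)
  then show ?case by blast
next
  case (add p q)
  then obtain J K where JK: "vars_le J p" "vars_le K q" by blast
  have "vars_le (max J K) (p + q)"
    by (intro vars_le_add vars_le_mono[OF JK(1)] vars_le_mono[OF JK(2)]) simp_all
  then show ?case by blast
qed

text \<open>Some bound always exists, and the step lowers it by \<open>n\<close> until it reaches
  \<open>K\<close>.\<close>

lemma vars_le_descend:
  assumes "0 < n" and step: "\<And>J. vars_le J f \<Longrightarrow> vars_le (max K (J - int n)) f"
  shows "vars_le K f"
proof -
  obtain J where "vars_le J f" using vars_le_exists by blast
  moreover have "vars_le J f \<Longrightarrow> vars_le K f"
  proof (induction "nat (J - K)" arbitrary: J rule: less_induct)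
    case less
    show ?case
    proof (cases "J \<le> K")
      case True
      then show ?thesis using less.prems by (rule vars_le_mono[rotated])
    next
      case False
      then show ?thesis using less.hyps[OF _ step[OF less.prems]] \<open>0 < n\<close> by simp
    qed
  qed
  ultimately show ?thesis by blast
qed

text \<open>Write \<open>f\<close> as the given difference plus \<open>shift (- int n) f\<close>;
  the second summand improves any bound of \<open>f\<close> by \<open>n\<close>.\<close>

lemma vars_le_diff_shift:
  assumes "0 < n" "vars_le K (f - shift (- int n) f)"
  shows "vars_le K f"
  using \<open>0 < n\<close>
proof (rule vars_le_descend)
  fix J assume J: "vars_le J f"
  have "vars_le (max K (J - int n)) (shift (- int n) f)"
    by (simp add: vars_le_mono[OF J])
  moreover have "vars_le (max K (J - int n)) (f - shift (- int n) f)"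
    by (rule vars_le_mono[OF assms(2)]) simp
  ultimately show "vars_le (max K (J - int n)) f"
    using vars_le_add by fastforce
qed

text \<open>The difference of \<open>f\<close> and its shift is 0, so every integer bounds the
  shifts in \<open>f\<close>, and no variable can occur.\<close>

lemma shift_invariant_const:
  fixes f :: "'m dpoly"
  assumes "0 < n" "shift (- int n) f = f"
  obtains c where "f = dconst c"
proof -
  have le: "vars_le K f" for K
    by (rule vars_le_diff_shift[OF \<open>0 < n\<close>]) (simp add: assms(2))
  have "Poly_Mapping.keys f \<subseteq> {0}"
  proof
    fix x assume x: "x \<in> Poly_Mapping.keys f"
    have "Poly_Mapping.keys x = {}"
    proof (rule ccontr)
      assume "Poly_Mapping.keys x \<noteq> {}"
      then obtain i j where "(i, j) \<in> Poly_Mapping.keys x" by (metis all_not_in_conv surj_pair)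
      then show False using le[of "j - 1"] x unfolding vars_le_def by fastforce
    qed
    then show "x \<in> {0}" by simp
  qed
  then have "f = Poly_Mapping.single 0 (Poly_Mapping.lookup f 0)"
    by (intro poly_mapping_eqI) (auto simp: lookup_single when_def in_keys_iff)
  then show thesis by (intro that) (simp add: dconst_def)
qed


section \<open>Divisibility by a variable\<close>

text \<open>Multiplication by a variable translates exponents injectively, which reduces
  cancellation and divisibility to statements about single monomials.\<close>

lemma dvar_mult_lookup:
  "Poly_Mapping.lookup (dvar i j * f) (Poly_Mapping.single (i, j) (Suc 0) + x) = Poly_Mapping.lookup f x"
proof (induction f rule: dpoly_induct)
  case (single y c)
  show ?case by (simp add: dvar_def mult_single lookup_single)
qed (simp add: distrib_left lookup_add)

lemma dvar_mult_cancel: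
  assumes "dvar i j * f = dvar i j * g"
  shows "f = g"
  by (rule poly_mapping_eqI) (metis assms dvar_mult_lookup)

lemma keys_dvar_mult:
  "Poly_Mapping.keys (dvar i j * f) = (+) (Poly_Mapping.single (i, j) (Suc 0)) ` Poly_Mapping.keys f"
proof
  show "Poly_Mapping.keys (dvar i j * f) \<subseteq> (+) (Poly_Mapping.single (i, j) (Suc 0)) ` Poly_Mapping.keys f"
    using Poly_Mapping.keys_mult[of "dvar i j" f] by (auto simp: dvar_def)
  show "(+) (Poly_Mapping.single (i, j) (Suc 0)) ` Poly_Mapping.keys f \<subseteq> Poly_Mapping.keys (dvar i j * f)"
    by (auto simp: in_keys_iff dvar_mult_lookup)
qed

lemma dvar_dvdI:
  assumes "\<And>x. x \<in> Poly_Mapping.keys f \<Longrightarrow> (i, j) \<in> Poly_Mapping.keys x"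
  obtains g where "f = dvar i j * g"
proof -
  let ?y = "Poly_Mapping.single (i, j) (Suc 0)"
  have inj: "inj ((+) ?y)" by simp
  \<comment> \<open>\<open>map_key\<close> precomposes, so \<open>g\<close> takes at
    \<open>x\<close> the coefficient that \<open>f\<close> has at \<open>?y + x\<close>.\<close>
  define g where "g = Poly_Mapping.map_key ((+) ?y) f"
  have "f = dvar i j * g"
  proof (rule poly_mapping_eqI)
    fix x
    show "Poly_Mapping.lookup f x = Poly_Mapping.lookup (dvar i j * g) x"
    proof (cases "(i, j) \<in> Poly_Mapping.keys x")
      case True
      have "x = ?y + (x - ?y)"
        using True by (intro poly_mapping_eqI)
          (auto simp: lookup_add lookup_minus lookup_single when_def in_keys_iff)
      then obtain z where z: "x = ?y + z" by blast
      show ?thesis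
        by (simp only: z dvar_mult_lookup) (simp add: g_def map_key.rep_eq[OF inj])
    next
      case False
      then have "x \<notin> Poly_Mapping.keys f" using assms by blast
      moreover have "x \<notin> Poly_Mapping.keys (dvar i j * g)"
        using False by (auto simp: keys_dvar_mult in_keys_iff lookup_add)
      ultimately show ?thesis by (simp add: in_keys_iff)
    qed
  qed
  then show thesis by (rule that)
qed

text \<open>Each monomial on the left contains \<open>(i, 0)\<close>, and the factor
  \<open>dvar i e\<close> with \<open>e \<noteq> 0\<close> cannot supply it.\<close>

lemma dvar_dvd_mult_dvar:
  assumes "dvar i e * f = dvar i 0 * g" "e \<noteq> 0"
  obtains f' where "f = dvar i 0 * f'"
proof (rule dvar_dvdI)
  fix x assume "x \<in> Poly_Mapping.keys f"
  then have "Poly_Mapping.single (i, e) (Suc 0) + x \<in> Poly_Mapping.keys (dvar i 0 * g)"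
    by (simp add: keys_dvar_mult flip: assms(1))
  then obtain y where "Poly_Mapping.single (i, e) (Suc 0) + x = Poly_Mapping.single (i, 0) (Suc 0) + y"
    by (auto simp: keys_dvar_mult)
  then have "Poly_Mapping.lookup (Poly_Mapping.single (i, e) (Suc 0) + x) (i, 0)
      = Poly_Mapping.lookup (Poly_Mapping.single (i, 0) (Suc 0) + y) (i, 0)" by simp
  then show "(i, 0) \<in> Poly_Mapping.keys x"
    using \<open>e \<noteq> 0\<close> by (simp add: lookup_add in_keys_iff lookup_single)
qed (rule that)

text \<open>The right side has its variables bounded by the larger of 0 and \<open>J - Q\<close>, so
  the bound on \<open>f\<close> descends to 0. For nonzero \<open>f\<close> the left side contains a
  variable of shift \<open>e > 0\<close>, a contradiction.\<close>

lemma no_positive_solution: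
  fixes f :: "'m dpoly"
  assumes eq: "dvar i e * f = dvar i 0 * shift (- int Q) f" and "0 < e" "0 < Q"
  shows "f = 0"
proof (rule ccontr)
  assume "f \<noteq> 0"
  then have "Poly_Mapping.keys f \<noteq> {}" by simp
  then obtain x where x: "x \<in> Poly_Mapping.keys f" by blast
  have step: "vars_le (max 0 (J - int Q)) (dvar i e * f)" if "vars_le J f" for J
    unfolding eq using that by (intro vars_le_mult vars_le_dvar) (simp_all add: vars_le_mono[OF that])
  have conv: "vars_le J f" if "vars_le J (dvar i e * f)" for J
    unfolding vars_le_def
  proof (intro ballI, clarify)
    fix y a b assume "y \<in> Poly_Mapping.keys f" "(a, b) \<in> Poly_Mapping.keys y"
    then have "Poly_Mapping.single (i, e) (Suc 0) + y \<in> Poly_Mapping.keys (dvar i e * f)"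
      "(a, b) \<in> Poly_Mapping.keys (Poly_Mapping.single (i, e) (Suc 0) + y)"
      by (simp_all add: keys_dvar_mult in_keys_iff lookup_add)
    then show "b \<le> J" using that unfolding vars_le_def by blast
  qed
  have "vars_le 0 f"
    by (rule vars_le_descend[OF \<open>0 < Q\<close>]) (rule conv[OF step])
  then have "vars_le (max 0 (0 - int Q)) (dvar i e * f)" by (rule step)
  then have "vars_le 0 (dvar i e * f)" by simp
  moreover have "Poly_Mapping.single (i, e) (Suc 0) + x \<in> Poly_Mapping.keys (dvar i e * f)"
    using x by (simp add: keys_dvar_mult)
  moreover have "(i, e) \<in> Poly_Mapping.keys (Poly_Mapping.single (i, e) (Suc 0) + x)"
    by (simp add: in_keys_iff lookup_add)
  ultimately show False
    using \<open>0 < e\<close> unfolding vars_le_def by (metis (mono_tags, lifting) case_prodD not_le)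
qed


section \<open>Commutators with the Lax operator\<close>

locale lax_operator =
  fixes N :: nat and Ns :: "'m::finite \<Rightarrow> nat"
  assumes N_pos: "0 < N" and N_less: "\<And>i. N < Ns i" and Ns_inj: "inj Ns"
begin

abbreviation L :: "'m psdo" where
  "L \<equiv> lax_op N Ns"

text \<open>The order \<open>-N\<close> is not allowed either: the coefficient 1 of \<open>L\<close>
  there is killed by every derivation.\<close>

abbreviation lax_flow_op :: "'m psdo \<Rightarrow> bool" where
  "lax_flow_op A \<equiv> (\<forall>k. k \<notin> range (\<lambda>i. - int (Ns i)) \<longrightarrow> pd_coeff (commutator A L) k = 0)"

lemma N_neq_Ns [simp]: "N \<noteq> Ns i" "Ns i \<noteq> N"
  using N_less[of i] by simp_all

section \<open>Coefficients of \<open>L\<close> and of products with \<open>L\<close>\<close>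

lemma pd_coeff_sum_monom:
  "pd_coeff (\<Sum>i\<in>UNIV. monom_op (g i) (- int (Ns i))) (- int (Ns i)) = g i"
  by (simp add: pd_coeff_sum inj_eq[OF Ns_inj] eq_commute[of i])

lemma pd_coeff_sum_monom_0:
  assumes "k \<notin> range (\<lambda>i. - int (Ns i))"
  shows "pd_coeff (\<Sum>i\<in>UNIV. monom_op (g i) (- int (Ns i))) k = 0"
  unfolding pd_coeff_sum using assms by (intro sum.neutral) auto

lemma pd_coeff_L_N: "pd_coeff L (- int N) = 1"
proof -
  have "- int N \<notin> range (\<lambda>i. - int (Ns i))" by auto
  then show ?thesis
    using pd_coeff_sum_monom_0[of "- int N" "\<lambda>i. dvar i 0"] by (simp add: lax_op_def)
qed

lemma pd_coeff_L_Ns: "pd_coeff L (- int (Ns i)) = dvar i 0"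
  using pd_coeff_sum_monom[of "\<lambda>i. dvar i 0" i] by (simp add: lax_op_def)

lemma pd_coeff_L_0:
  "k \<noteq> - int N \<Longrightarrow> k \<notin> range (\<lambda>i. - int (Ns i)) \<Longrightarrow> pd_coeff L k = 0"
  using pd_coeff_sum_monom_0[of k "\<lambda>i. dvar i 0"] by (simp add: lax_op_def)

lemma pd_coeff_L_above:
  assumes "k > - int N"
  shows "pd_coeff L k = 0"
proof (rule pd_coeff_L_0)
  show "k \<notin> range (\<lambda>i. - int (Ns i))"
  proof clarify
    fix i assume "k = - int (Ns i)"
    with assms N_less[of i] show False by simp
  qed
qed (use assms in simp)

lemma dvar_neq_0: "dvar i j \<noteq> 0"
proof
  assume "dvar i j = 0"
  then have "Poly_Mapping.lookup (dvar i j) (Poly_Mapping.single (i, j) 1) = 0" by simp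
  then show False by (simp add: dvar_def)
qed

lemma pd_supp_L: "pd_supp L = insert (- int N) (range (\<lambda>i. - int (Ns i)))"
proof
  show "pd_supp L \<subseteq> insert (- int N) (range (\<lambda>i. - int (Ns i)))"
    by (rule subsetI, rule ccontr) (simp add: pd_supp_def pd_coeff_L_0)
  show "insert (- int N) (range (\<lambda>i. - int (Ns i))) \<subseteq> pd_supp L"
    by (auto simp: pd_supp_def pd_coeff_L_N pd_coeff_L_Ns dvar_neq_0)
qed

lemma pd_coeff_mult_L:
  "pd_coeff (P * L) k = pd_coeff P (k + int N)
     + (\<Sum>i\<in>UNIV. pd_coeff P (k + int (Ns i)) * dvar i (k + int (Ns i)))"
  by (simp add: lax_op_def distrib_left sum_distrib_left pd_coeff_sum pd_coeff_mult_monom_op shift_dvar)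

lemma pd_coeff_L_mult:
  "pd_coeff (L * P) k = shift (- int N) (pd_coeff P (k + int N))
     + (\<Sum>i\<in>UNIV. dvar i 0 * shift (- int (Ns i)) (pd_coeff P (k + int (Ns i))))"
  by (simp add: lax_op_def distrib_right sum_distrib_right pd_coeff_sum pd_coeff_monom_op_mult)

lemma pd_coeff_commutator_L:
  "pd_coeff (commutator A L) k
     = (pd_coeff A (k + int N) - shift (- int N) (pd_coeff A (k + int N)))
       + (\<Sum>i\<in>UNIV. pd_coeff A (k + int (Ns i)) * dvar i (k + int (Ns i))
            - dvar i 0 * shift (- int (Ns i)) (pd_coeff A (k + int (Ns i))))"
  by (simp add: commutator_def pd_coeff_mult_L pd_coeff_L_mult sum_subtractf)

section \<open>Orders and lowest coefficients of the powers of \<open>L\<close>\<close>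

lemma lax_power_above: "k > - int (r * N) \<Longrightarrow> pd_coeff (L ^ r) k = 0"
proof (induction r arbitrary: k)
  case (Suc r)
  show ?case
    by (simp only: power_Suc, rule pd_coeff_mult_above[of "- int N" _ "- int (r * N)"])
       (use Suc pd_coeff_L_above in auto)
qed simp

lemma lax_power_below:
  assumes Q: "\<And>i. Ns i \<le> Q"
  shows "k < - int (r * Q) \<Longrightarrow> pd_coeff (L ^ r) k = 0"
proof (induction r arbitrary: k)
  case (Suc r)
  have N: "int N \<le> int Q" using Q N_less by (meson less_imp_le_nat of_nat_mono order_trans)
  have "pd_coeff (L ^ r) (k + int (Ns i)) = 0" for i
    using Suc Q[of i] by (intro Suc.IH) (simp add: algebra_simps)
  moreover have "pd_coeff (L ^ r) (k + int N) = 0"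
    using Suc.prems N by (intro Suc.IH) (simp add: algebra_simps)
  ultimately show ?case by (simp add: pd_coeff_L_mult)
qed simp

text \<open>The lowest order arises only from the lowest terms of both factors, and by injectivity
  \<open>i0\<close> alone attains the largest exponent.\<close>

lemma lax_power_bottom:
  assumes Q: "\<And>i. Ns i \<le> Ns i0"
  shows "pd_coeff (L ^ Suc r) (- int (Suc r * Ns i0))
     = dvar i0 0 * shift (- int (Ns i0)) (pd_coeff (L ^ r) (- int (r * Ns i0)))"
proof -
  let ?Q = "Ns i0" and ?k = "- int (Suc r * Ns i0)"
  have z: "pd_coeff (L ^ r) (?k + int n) = 0" if "n < ?Q" for n
    using that by (intro lax_power_below[OF Q]) (simp add: algebra_simps)
  have "(\<Sum>i\<in>UNIV. dvar i 0 * shift (- int (Ns i)) (pd_coeff (L ^ r) (?k + int (Ns i))))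
      = (\<Sum>i\<in>{i0}. dvar i 0 * shift (- int (Ns i)) (pd_coeff (L ^ r) (?k + int (Ns i))))"
  proof (rule sum.mono_neutral_right)
    show "\<forall>i\<in>UNIV - {i0}. dvar i 0 * shift (- int (Ns i)) (pd_coeff (L ^ r) (?k + int (Ns i))) = 0"
    proof
      fix i assume "i \<in> UNIV - {i0}"
      then have "Ns i < ?Q" using Q[of i] Ns_inj by (metis DiffD2 injD insertI1 le_neq_implies_less)
      then show "dvar i 0 * shift (- int (Ns i)) (pd_coeff (L ^ r) (?k + int (Ns i))) = 0"
        by (simp only: z shift_zero mult_zero_right)
    qed
  qed auto
  moreover have "?k + int ?Q = - int (r * ?Q)" by (simp add: algebra_simps)
  ultimately show ?thesis
    using z[OF N_less] by (simp only: power_Suc pd_coeff_L_mult) simp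
qed

text \<open>
  The lowest coefficient of an operator of negative order whose commutator with \<open>L\<close> has support
  above that of \<open>L\<close> satisfies the equation assumed here; its solutions are the lowest coefficients
  of the powers of \<open>L\<close>.
\<close>

lemma bottom_coeff_solution:
  assumes Q: "\<And>i. Ns i \<le> Ns i0"
  shows "dvar i0 e * b = dvar i0 0 * shift (- int (Ns i0)) b \<Longrightarrow> b \<noteq> 0 \<Longrightarrow>
    \<exists>r c. e = - int (r * Ns i0) \<and> b = dconst c * pd_coeff (L ^ r) e"
proof (induction "nat (- e)" arbitrary: e b rule: less_induct)
  case less
  let ?Q = "Ns i0"
  have Qpos: "0 < ?Q" using N_less[of i0] by simp
  consider "e > 0" | "e = 0" | "e < 0" by linarith
  then show ?case
  proof cases
    case 1
    then show ?thesis using no_positive_solution[OF less.prems(1) _ Qpos] less.prems(2) by blast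
  next
    case 2
    then have "shift (- int ?Q) b = b" using less.prems(1) dvar_mult_cancel by metis
    then obtain c where "b = dconst c" using shift_invariant_const[OF Qpos] by blast
    then show ?thesis using 2 by (intro exI[of _ 0] exI[of _ c]) simp
  next
    case 3
    \<comment> \<open>For \<open>e < 0\<close> the variable divides \<open>b\<close>. Cancelling it
      and shifting by \<open>?Q\<close> yields the same equation at \<open>e + ?Q\<close>, which is
      closer to or beyond 0.\<close>
    obtain b' where b': "b = dvar i0 0 * b'"
      using dvar_dvd_mult_dvar[OF less.prems(1)] 3 by blast
    define d where "d = shift (int ?Q) b'"
    have b: "b = dvar i0 0 * shift (- int ?Q) d"
      by (simp add: b' d_def shift_shift)
    have "dvar i0 0 * (dvar i0 e * b') = dvar i0 0 * (dvar i0 (- int ?Q) * shift (- int ?Q) b')"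
      using less.prems(1) by (simp add: b' shift_mult shift_dvar mult.left_commute)
    then have "dvar i0 e * b' = dvar i0 (- int ?Q) * shift (- int ?Q) b'"
      by (rule dvar_mult_cancel)
    then have "shift (int ?Q) (dvar i0 e * b') = shift (int ?Q) (dvar i0 (- int ?Q) * shift (- int ?Q) b')"
      by simp
    then have "dvar i0 (e + int ?Q) * d = dvar i0 0 * shift (- int ?Q) d"
      by (simp add: d_def shift_mult shift_dvar shift_shift)
    moreover have "d \<noteq> 0" using less.prems(2) b by auto
    ultimately obtain r c where rc: "e + int ?Q = - int (r * ?Q)" "d = dconst c * pd_coeff (L ^ r) (e + int ?Q)"
      using less.hyps[of "e + int ?Q" d] 3 Qpos by auto
    have e: "e = - int (Suc r * ?Q)" using rc(1) by (simp add: algebra_simps)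
    have "b = dconst c * pd_coeff (L ^ Suc r) e"
      unfolding e lax_power_bottom[OF Q]
      by (simp only: b rc shift_mult shift_dconst mult.left_commute)
    then show ?thesis using e by blast
  qed
qed

text \<open>Negative orders are cleared from below. A lowest coefficient of order
  \<open>e < 0\<close> alone determines the commutator at \<open>e - Ns i0\<close>, below the
  support of \<open>L\<close>. If nonzero it is matched by a multiple of a power of
  \<open>L\<close>; subtracting that changes neither the commutator nor the nonnegative
  part.\<close>

lemma commutator_pos_part:
  assumes Q: "\<And>i. Ns i \<le> Ns i0"
  shows "(\<And>k. k < - int n \<Longrightarrow> pd_coeff A k = 0) \<Longrightarrow> lax_flow_op A \<Longrightarrow>
    commutator (pos_part A) L = commutator A L"
proof (induction n arbitrary: A)
  case 0
  then have "pos_part A = A" by (intro psdo_eqI) simp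
  then show ?case by simp
next
  case (Suc n)
  let ?Q = "Ns i0"
  define e where "e = - int (Suc n)"
  define b where "b = pd_coeff A e"
  have z: "pd_coeff A (e - int ?Q + int j) = 0" if "j < ?Q" for j
    using that by (intro Suc.prems(1)) (simp add: e_def)
  have "pd_coeff (commutator A L) (e - int ?Q) = 0"
  proof -
    have "e - int ?Q \<noteq> - int (Ns i)" for i
      using Q[of i] by (simp add: e_def)
    then show ?thesis using Suc.prems(2) by auto
  qed
  moreover have "(\<Sum>i\<in>UNIV. pd_coeff A (e - int ?Q + int (Ns i)) * dvar i (e - int ?Q + int (Ns i))
            - dvar i 0 * shift (- int (Ns i)) (pd_coeff A (e - int ?Q + int (Ns i))))
      = (\<Sum>i\<in>{i0}. pd_coeff A (e - int ?Q + int (Ns i)) * dvar i (e - int ?Q + int (Ns i))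
            - dvar i 0 * shift (- int (Ns i)) (pd_coeff A (e - int ?Q + int (Ns i))))"
  proof (rule sum.mono_neutral_right)
    show "\<forall>i\<in>UNIV - {i0}. pd_coeff A (e - int ?Q + int (Ns i)) * dvar i (e - int ?Q + int (Ns i))
            - dvar i 0 * shift (- int (Ns i)) (pd_coeff A (e - int ?Q + int (Ns i))) = 0"
    proof
      fix i assume "i \<in> UNIV - {i0}"
      then have "Ns i < ?Q" using Q[of i] Ns_inj by (metis DiffD2 injD insertI1 le_neq_implies_less)
      then show "pd_coeff A (e - int ?Q + int (Ns i)) * dvar i (e - int ?Q + int (Ns i))
            - dvar i 0 * shift (- int (Ns i)) (pd_coeff A (e - int ?Q + int (Ns i))) = 0"
        by (simp only: z) simp
    qed
  qed auto
  ultimately have eq: "dvar i0 e * b = dvar i0 0 * shift (- int ?Q) b"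
    using z[OF N_less] by (simp add: pd_coeff_commutator_L b_def mult.commute)
  show ?case
  proof (cases "b = 0")
    case True
    have "pd_coeff A k = 0" if "k < - int n" for k
      using that Suc.prems(1)[of k] True by (cases "k = e") (auto simp: b_def e_def)
    then show ?thesis by (rule Suc.IH) (use Suc.prems in auto)
  next
    case False
    obtain r c where rc: "e = - int (r * ?Q)" "b = dconst c * pd_coeff (L ^ r) e"
      using bottom_coeff_solution[OF Q eq False] by blast
    then have r: "r > 0" by (cases r) (auto simp: e_def)
    define P where "P = monom_op (dconst c) 0 * L ^ r"
    have P: "pd_coeff P k = dconst c * pd_coeff (L ^ r) k" for k
      by (simp add: P_def pd_coeff_monom_op_mult)
    have "commutator P L = 0"
      unfolding commutator_def P_def
      by (metis (no_types, lifting) dconst_op_central diff_self mult.assoc power_commutes)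
    then have com: "commutator (A - P) L = commutator A L"
      by (simp add: commutator_diff_left)
    have P0: "pd_coeff P k = 0" if "k \<ge> 0" for k
    proof -
      have "- int (r * N) < 0" using r N_pos by simp
      with that show ?thesis by (simp only: P) (simp add: lax_power_above)
    qed
    have "pos_part (A - P) = pos_part A"
      by (rule psdo_eqI) (simp add: P0)
    moreover have "commutator (pos_part (A - P)) L = commutator (A - P) L"
    proof (rule Suc.IH)
      fix k assume k: "k < - int n"
      show "pd_coeff (A - P) k = 0"
      proof (cases "k = e")
        case True
        then show ?thesis using rc(2) by (simp add: P b_def)
      next
        case False
        then have "k < e" using k by (simp add: e_def)
        then show ?thesis
          using Suc.prems(1)[of k] lax_power_below[OF Q, of k r]
          by (simp only: P rc(1)[symmetric] minus_psdo.rep_eq) (simp add: e_def)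
      qed
    qed (use Suc.prems com in auto)
    ultimately show ?thesis using com by simp
  qed
qed

end


section \<open>Numerical semigroups\<close>

inductive_set semigroup_gen :: "nat set \<Rightarrow> nat set" for T where
  zero: "0 \<in> semigroup_gen T"
| step: "x \<in> semigroup_gen T \<Longrightarrow> t \<in> T \<Longrightarrow> x + t \<in> semigroup_gen T"

lemma semigroup_gen_add:
  "y \<in> semigroup_gen T \<Longrightarrow> x \<in> semigroup_gen T \<Longrightarrow> x + y \<in> semigroup_gen T"
  by (induction y rule: semigroup_gen.induct) (auto intro: semigroup_gen.step simp flip: add.assoc)

lemma semigroup_gen_mult: "x \<in> semigroup_gen T \<Longrightarrow> n * x \<in> semigroup_gen T"
  by (induction n) (auto intro: semigroup_gen.zero semigroup_gen_add)

lemma semigroup_gen_mono: "x \<in> semigroup_gen T \<Longrightarrow> T \<subseteq> U \<Longrightarrow> x \<in> semigroup_gen U"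
  by (induction x rule: semigroup_gen.induct) (auto intro: semigroup_gen.intros)

lemma semigroup_gen_base: "t \<in> T \<Longrightarrow> t \<in> semigroup_gen T"
  using semigroup_gen.step[OF semigroup_gen.zero] by fastforce

text \<open>Bezout by induction on the generators, with negative terms moved to the other side so
  that all coefficients stay natural.\<close>

lemma semigroup_gen_Gcd:
  assumes "finite T"
  shows "\<exists>x\<in>semigroup_gen T. \<exists>y\<in>semigroup_gen T. x = y + Gcd T"
  using assms
proof (induction T)
  case empty
  show ?case by (auto intro: semigroup_gen.zero)
next
  case (insert a T)
  let ?G = "semigroup_gen (insert a T)"
  obtain x y where "x \<in> semigroup_gen T" "y \<in> semigroup_gen T" and xy: "x = y + Gcd T"
    using insert.IH by blast
  then have G: "x \<in> ?G" "y \<in> ?G" "a \<in> ?G"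
    by (auto intro: semigroup_gen_mono semigroup_gen_base)
  show ?case
  proof (cases "a = 0")
    case True
    then show ?thesis using G xy by auto
  next
    case False
    obtain u v where uv: "a * u = Gcd T * v + gcd a (Gcd T)"
      using bezout_nat[OF False] by blast
    have "u * a + v * y = v * x + Gcd (insert a T)"
      using uv by (simp add: xy algebra_simps)
    then show ?thesis
      using G by (meson semigroup_gen_add semigroup_gen_mult)
  qed
qed

text \<open>Take \<open>x = y + p\<close> with \<open>y = p * t\<close>, and let
  \<open>n = p * k\<close>. Then \<open>n = (k div t - k mod t) * y + (k mod t) * x\<close>, where
  the first coefficient is nonnegative once \<open>k \<ge> t * t\<close>; the bound
  \<open>y * y\<close> ensures this.\<close>

lemma semigroup_gen_conductor:
  assumes "finite T"
  obtains B where "\<And>n. n \<ge> B \<Longrightarrow> Gcd T dvd n \<Longrightarrow> n \<in> semigroup_gen T"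
proof -
  let ?p = "Gcd T" and ?G = "semigroup_gen T"
  obtain x y where G: "x \<in> ?G" "y \<in> ?G" and xy: "x = y + ?p"
    using semigroup_gen_Gcd[OF assms] by blast
  have "n \<in> ?G" if n: "n \<ge> y * y" "?p dvd n" for n
  proof (cases "y = 0 \<or> ?p = 0")
    case True
    then show ?thesis
    proof
      assume "y = 0"
      then show ?thesis using n(2) G xy semigroup_gen_mult by (metis add_0 dvd_def mult.commute)
    next
      assume "?p = 0"
      then show ?thesis using n(2) by (metis dvd_0_left semigroup_gen.zero)
    qed
  next
    case False
    have "\<forall>g\<in>?G. ?p dvd g"
    proof
      fix g assume "g \<in> ?G"
      then show "?p dvd g"
        by (induction g rule: semigroup_gen.induct) (simp_all add: Gcd_dvd dvd_add)
    qed
    then obtain t where t: "y = ?p * t" using G(2) by auto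
    obtain k where k: "n = ?p * k" using n(2) by blast
    have tpos: "t > 0" using False t by (cases t) auto
    have "t * t \<le> k"
    proof -
      have p: "0 < ?p" using False by blast
      have "?p * (t * t) \<le> ?p * (?p * (t * t))"
        using p by (intro mult_le_mono2) (cases ?p, auto)
      also have "\<dots> = y * y" by (simp only: t ac_simps)
      also have "\<dots> \<le> ?p * k" using n(1) k by simp
      finally show ?thesis using p by (metis nat_mult_le_cancel1)
    qed
    then have "t \<le> k div t" using tpos by (simp add: less_eq_div_iff_mult_less_eq)
    moreover have "k mod t < t" using tpos by simp
    ultimately have "k div t = (k div t - k mod t) + k mod t" by linarith
    then have "k = ((k div t - k mod t) + k mod t) * t + k mod t"
      by (metis div_mult_mod_eq)
    then have "n = ?p * (((k div t - k mod t) + k mod t) * t + k mod t)" using k by argo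
    also have "\<dots> = (k div t - k mod t) * y + (k mod t) * x"
      by (simp add: xy t algebra_simps)
    finally show ?thesis
      using G semigroup_gen_add semigroup_gen_mult by metis
  qed
  then show thesis by (rule that)
qed


section \<open>Lax flows of bounded order\<close>

context lax_operator
begin

text \<open>A filtration of the flows by the order of a nonnegative auxiliary operator.\<close>

definition flows_le :: "nat \<Rightarrow> ('m dpoly \<Rightarrow> 'm dpoly) set" where
  "flows_le d = {D. is_derivation D \<and> (\<forall>f. D (shift 1 f) = shift 1 (D f)) \<and>
     (\<exists>A. (\<forall>k<0. pd_coeff A k = 0) \<and> (\<forall>k>int d. pd_coeff A k = 0) \<and>
        deriv_lax_op Ns D = commutator A L)}"

lemma deriv_lax_op_flow:
  assumes "deriv_lax_op Ns D = commutator A L"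
  shows "lax_flow_op A"
  by (simp add: pd_coeff_sum_monom_0 deriv_lax_op_def flip: assms)

lemma deriv_lax_op_coeff: "pd_coeff (deriv_lax_op Ns D) (- int (Ns i)) = D (dvar i 0)"
  unfolding deriv_lax_op_def by (rule pd_coeff_sum_monom)

lemma N_notin_range: "k \<ge> - int N \<Longrightarrow> k \<notin> range (\<lambda>i. - int (Ns i))"
proof clarify
  fix i assume "- int N \<le> - int (Ns i)"
  then show False using N_less[of i] by simp
qed

text \<open>At order \<open>d - N\<close> of the commutator only the top coefficient occurs, and the
  vanishing there makes it shift-invariant.\<close>

lemma top_coeff_const:
  assumes "lax_flow_op A" "\<And>k. k > int d \<Longrightarrow> pd_coeff A k = 0"
  obtains c where "pd_coeff A (int d) = dconst c"
proof -
  let ?k = "int d - int N"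
  have "pd_coeff A (?k + int (Ns i)) = 0" for i
    using N_less[of i] by (intro assms(2)) simp
  moreover have "pd_coeff (commutator A L) ?k = 0"
    using assms(1) N_notin_range[of ?k] by simp
  ultimately have "shift (- int N) (pd_coeff A (int d)) = pd_coeff A (int d)"
    by (simp add: pd_coeff_commutator_L)
  then show thesis
    using shift_invariant_const[OF N_pos] that by blast
qed

lemma flows_le_0:
  assumes "D \<in> flows_le 0"
  shows "D = 0"
proof -
  obtain A where D: "is_derivation D" "\<And>f. D (shift 1 f) = shift 1 (D f)"
    and A: "\<And>k. k < 0 \<Longrightarrow> pd_coeff A k = 0" "\<And>k. k > int 0 \<Longrightarrow> pd_coeff A k = 0"
      "deriv_lax_op Ns D = commutator A L"
    using assms unfolding flows_le_def by blast
  obtain c where c: "pd_coeff A (int 0) = dconst c"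
    using top_coeff_const[OF deriv_lax_op_flow[OF A(3)], of 0] A(2) by blast
  have "A = monom_op (dconst c) 0"
    using A(1,2) c by (intro psdo_eqI) (metis linorder_neqE_linordered_idom of_nat_0 pd_coeff_monom_op)
  then have "deriv_lax_op Ns D = 0"
    by (simp add: A(3) commutator_def dconst_op_central)
  then have "D (dvar i 0) = 0" for i
    using deriv_lax_op_coeff[of D i] by simp
  then show ?thesis
    using derivation_zeroI[OF D] by (intro ext) simp
qed

lemma flows_le_mono: "d \<le> e \<Longrightarrow> flows_le d \<subseteq> flows_le e"
  unfolding flows_le_def by fastforce

lemma lax_flow_flows_le:
  assumes "lax_flow N Ns D"
  obtains d where "D \<in> flows_le d"
proof -
  obtain A where D: "is_derivation D" "\<And>f. D (shift 1 f) = shift 1 (D f)"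
    and A: "is_diffop A" "deriv_lax_op Ns D = commutator A L"
    using assms unfolding lax_flow_def lax_flow_by_def by blast
  obtain i0 where i0: "\<And>i. Ns i \<le> Ns i0"
    using Max_in[of "range Ns"] Max_ge[of "range Ns"] by fastforce
  obtain b where b: "\<And>k. k < b \<Longrightarrow> pd_coeff A k = 0"
    using A(1) unfolding is_diffop_iff by blast
  obtain a where a: "\<And>k. k > a \<Longrightarrow> pd_coeff A k = 0" using pd_coeff_bound by blast
  have "commutator (pos_part A) L = commutator A L"
    by (rule commutator_pos_part[OF i0, where n = "nat (- b)"])
       (use b deriv_lax_op_flow[OF A(2)] in \<open>auto split: if_splits\<close>)
  then have "D \<in> flows_le (nat a)"
    unfolding flows_le_def using D A(2) a by (auto intro!: exI[of _ "pos_part A"])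
  then show thesis by (rule that)
qed

lemma derivation_diff_scale:
  assumes "is_derivation D" "is_derivation D'"
  shows "is_derivation (D - scale_map c D')"
  unfolding is_derivation_def
proof (intro conjI allI)
  show "(D - scale_map c D') (dconst a * f) = dconst a * (D - scale_map c D') f" for a f
    by (simp add: scale_map_def derivation_dconst_mult[OF assms(1)] derivation_dconst_mult[OF assms(2)]
        right_diff_distrib mult.left_commute)
qed (simp_all add: scale_map_def derivation_add[OF assms(1)] derivation_add[OF assms(2)]
        derivation_mult[OF assms(1)] derivation_mult[OF assms(2)] algebra_simps)

text \<open>Since top coefficients are constants, any flow of order \<open>Suc d\<close> minus a
  multiple of a fixed one has order at most \<open>d\<close>. Each stage thus adds at most one
  generator.\<close>

lemma flows_le_span: "\<exists>T. finite T \<and> flows_le d \<subseteq> flows.span T"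
proof (induction d)
  case 0
  show ?case
    using flows_le_0 flows.span_zero by (intro exI[of _ "{}"]) auto
next
  case (Suc d)
  then obtain T where T: "finite T" "flows_le d \<subseteq> flows.span T" by blast
  show ?case
  proof (cases "flows_le (Suc d) \<subseteq> flows_le d")
    case True
    then show ?thesis using T by blast
  next
    case False
    then obtain D' where D': "D' \<in> flows_le (Suc d)" "D' \<notin> flows_le d" by blast
    then obtain A' where dD': "is_derivation D'" "\<And>f. D' (shift 1 f) = shift 1 (D' f)"
      and A': "\<And>k. k < 0 \<Longrightarrow> pd_coeff A' k = 0" "\<And>k. k > int (Suc d) \<Longrightarrow> pd_coeff A' k = 0"
        "deriv_lax_op Ns D' = commutator A' L"
      unfolding flows_le_def by blast
    obtain c' where c': "pd_coeff A' (int (Suc d)) = dconst c'"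
      using top_coeff_const[OF deriv_lax_op_flow[OF A'(3)], of "Suc d"] A'(2) by blast
    have "c' \<noteq> 0"
    proof
      assume "c' = 0"
      then have "pd_coeff A' k = 0" if "k > int d" for k
        using that c' A'(2)[of k] by (cases "k = int (Suc d)") auto
      then have "D' \<in> flows_le d"
        unfolding flows_le_def using dD' A' by blast
      with D'(2) show False by simp
    qed
    have "flows_le (Suc d) \<subseteq> flows.span (insert D' T)"
    proof
      fix D assume "D \<in> flows_le (Suc d)"
      then obtain A where dD: "is_derivation D" "\<And>f. D (shift 1 f) = shift 1 (D f)"
        and A: "\<And>k. k < 0 \<Longrightarrow> pd_coeff A k = 0" "\<And>k. k > int (Suc d) \<Longrightarrow> pd_coeff A k = 0"
          "deriv_lax_op Ns D = commutator A L"
        unfolding flows_le_def by blast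
      obtain c where c: "pd_coeff A (int (Suc d)) = dconst c"
        using top_coeff_const[OF deriv_lax_op_flow[OF A(3)], of "Suc d"] A(2) by blast
      define a where "a = c / c'"
      define B where "B = A - monom_op (dconst a) 0 * A'"
      have B: "pd_coeff B k = pd_coeff A k - dconst a * pd_coeff A' k" for k
        by (simp add: B_def pd_coeff_monom_op_mult)
      have "pd_coeff B (int (Suc d)) = 0"
        unfolding B c c' dconst_mult[symmetric] using \<open>c' \<noteq> 0\<close> by (simp add: a_def)
      then have "pd_coeff B k = 0" if "k > int d" for k
        using that A(2)[of k] A'(2)[of k] B[of k] by (cases "k = int (Suc d)") auto
      moreover have "pd_coeff B k = 0" if "k < 0" for k
        using that A(1) A'(1) by (simp add: B)
      moreover have "deriv_lax_op Ns (D - scale_map a D') = commutator B L"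
      proof -
        have "deriv_lax_op Ns (D - scale_map a D')
            = deriv_lax_op Ns D - monom_op (dconst a) 0 * deriv_lax_op Ns D'"
          by (rule psdo_eqI)
             (simp add: deriv_lax_op_def scale_map_def pd_coeff_sum pd_coeff_monom_op_mult
               sum_distrib_left if_distrib[of "\<lambda>x. _ * x"] flip: sum_subtractf cong: if_cong,
              auto intro!: sum.cong)
        moreover have "monom_op (dconst a) 0 * commutator A' L = commutator (monom_op (dconst a) 0 * A') L"
          unfolding commutator_def
          by (metis (no_types, lifting) dconst_op_central mult.assoc right_diff_distrib)
        ultimately show ?thesis by (simp add: A(3) A'(3) B_def commutator_diff_left)
      qed
      ultimately have "D - scale_map a D' \<in> flows_le d"
        unfolding flows_le_def using derivation_diff_scale[OF dD(1) dD'(1), of a]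
        by (auto simp: dD(2) dD'(2) scale_map_def shift_diff shift_mult shift_dconst)
      then have "D - scale_map a D' \<in> flows.span (insert D' T)"
        using T(2) flows.span_mono[of T "insert D' T"] by blast
      moreover have "scale_map a D' \<in> flows.span (insert D' T)"
        by (intro flows.span_scale flows.span_base) simp
      ultimately have "(D - scale_map a D') + scale_map a D' \<in> flows.span (insert D' T)"
        by (rule flows.span_add)
      then show "D \<in> flows.span (insert D' T)" by simp
    qed
    then show ?thesis using T(1) by blast
  qed
qed

text \<open>An infinite independent family does not fit into the finite-dimensional span containing
  \<open>flows_le b\<close>.\<close>

lemma flow_of_large_order:
  assumes "infinite F" "F \<subseteq> {D. lax_flow N Ns D}" "flows.independent F"
  obtains A d c where "b < d" "lax_flow_op A" "\<And>k. k < 0 \<Longrightarrow> pd_coeff A k = 0"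
    "\<And>k. k > int d \<Longrightarrow> pd_coeff A k = 0" "pd_coeff A (int d) = dconst c" "c \<noteq> 0"
proof -
  have "\<not> F \<subseteq> flows_le b"
  proof
    assume "F \<subseteq> flows_le b"
    then obtain T where "finite T" "F \<subseteq> flows.span T"
      using flows_le_span[of b] by blast
    then show False using flows.independent_span_bound[of T F] assms by blast
  qed
  then obtain D where D: "D \<in> F" "D \<notin> flows_le b" by blast
  then obtain d' where "D \<in> flows_le d'"
    using assms(2) lax_flow_flows_le by blast
  \<comment> \<open>Minimality of \<open>d\<close> makes the top coefficient nonzero.\<close>
  define d where "d = (LEAST d. D \<in> flows_le d)"
  have d: "D \<in> flows_le d"
    unfolding d_def using \<open>D \<in> flows_le d'\<close> by (rule LeastI)
  have bd: "b < d"
    using D(2) d flows_le_mono[of d b] by (metis linorder_not_less subsetD)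
  obtain A where dD: "is_derivation D" "\<And>f. D (shift 1 f) = shift 1 (D f)"
    and A: "\<And>k. k < 0 \<Longrightarrow> pd_coeff A k = 0" "\<And>k. k > int d \<Longrightarrow> pd_coeff A k = 0"
      "deriv_lax_op Ns D = commutator A L"
    using d unfolding flows_le_def by blast
  obtain c where c: "pd_coeff A (int d) = dconst c"
    using top_coeff_const[OF deriv_lax_op_flow[OF A(3)], of d] A(2) by blast
  have "c \<noteq> 0"
  proof
    assume "c = 0"
    then have "pd_coeff A k = 0" if "k > int (d - 1)" for k
      using that c A(2)[of k] bd by (cases "k = int d") auto
    then have "D \<in> flows_le (d - 1)"
      unfolding flows_le_def using dD A by blast
    then show False
      using bd not_less_Least[of "d - 1" "\<lambda>d. D \<in> flows_le d"] by (simp add: d_def)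
  qed
  then show thesis
    using that[OF bd deriv_lax_op_flow[OF A(3)] A(1,2) c] by blast
qed

end


section \<open>The support of a Lax operator with many flows\<close>

text \<open>
  Setting all variables to \<open>-1\<close> turns the coefficients of \<open>A\<close> into positive multiples of \<open>c\<close>,
  without cancellation. Only the variables of shift \<open>d\<close> get the value \<open>-x\<close>; since the coefficients
  involve no variables of larger shift, any negative shift of a coefficient is independent of \<open>x\<close>,
  so that the difference between \<open>x = 2\<close> and \<open>x = 1\<close> obeys a recursion with positive terms only.
\<close>

locale positive_flow = lax_operator N Ns for N and Ns :: "'m::finite \<Rightarrow> nat" +
  fixes A :: "'m psdo" and d :: nat and c :: complex
  assumes flow: "\<And>k. k \<notin> range (\<lambda>i. - int (Ns i)) \<Longrightarrow> pd_coeff (commutator A (lax_op N Ns)) k = 0"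
    and neg: "\<And>k. k < 0 \<Longrightarrow> pd_coeff A k = 0"
    and above: "\<And>k. k > int d \<Longrightarrow> pd_coeff A k = 0"
    and top: "pd_coeff A (int d) = dconst c" and c_nonzero: "c \<noteq> 0" and d_pos: "0 < d"
begin

section \<open>Test points and the difference of their values\<close>

definition gap :: "'m \<Rightarrow> nat" where
  "gap i = Ns i - N"

lemma gap_pos: "0 < gap i"
  using N_less[of i] by (simp add: gap_def)

lemma gap_eq: "int (Ns i) = int N + int (gap i)"
  using N_less[of i] by (simp add: gap_def)

definition test_val :: "complex \<Rightarrow> 'm \<times> int \<Rightarrow> complex" where
  "test_val x = (\<lambda>(i, j). if j = int d then - x else - 1)"

definition delta :: "'m dpoly \<Rightarrow> complex" where
  "delta f = cx.poly_eval (test_val 2) f - cx.poly_eval (test_val 1) f"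

lemma delta_diff: "delta (f - g) = delta f - delta g"
  by (simp add: delta_def cx.poly_eval_diff)

lemma delta_add: "delta (f + g) = delta f + delta g"
  by (simp add: delta_def cx.poly_eval_add)

lemma delta_sum: "delta (sum f I) = (\<Sum>i\<in>I. delta (f i))"
  by (simp add: delta_def cx.poly_eval_sum sum_subtractf)

lemma delta_0 [simp]: "delta 0 = 0"
  by (simp add: delta_def)

lemma eval_vars_le:
  assumes "vars_le J f" "J < int d"
  shows "cx.poly_eval (test_val x) f = cx.poly_eval (test_val y) f"
  using assms by (intro cx.poly_eval_cong) (fastforce simp: vars_le_def test_val_def)

lemma delta_vars_le: "vars_le J f \<Longrightarrow> J < int d \<Longrightarrow> delta f = 0"
  unfolding delta_def using eval_vars_le[of J f 2 1] by simp

abbreviation lax_term :: "int \<Rightarrow> 'm \<Rightarrow> 'm dpoly" where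
  "lax_term t i \<equiv> pd_coeff A t * dvar i t - dvar i 0 * shift (- int (Ns i)) (pd_coeff A t)"

text \<open>This is the commutator at order \<open>k - N\<close>. As gaps are positive, the sum
  involves only coefficients of order above \<open>k\<close>, so the equation is a downward
  recursion.\<close>

lemma lax_equation:
  assumes "k - int N \<notin> range (\<lambda>i. - int (Ns i))"
  shows "pd_coeff A k - shift (- int N) (pd_coeff A k) + (\<Sum>i\<in>UNIV. lax_term (k + int (gap i)) i) = 0"
  using flow[OF assms] by (simp add: pd_coeff_commutator_L gap_eq algebra_simps)

text \<open>Downward induction from order \<open>d\<close>: a term of order \<open>t \<le> d\<close>
  brings in only the variables of shifts \<open>t\<close> and 0 besides those of
  \<open>pd_coeff A t\<close>, and \<open>vars_le_diff_shift\<close> passes the bound on to the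
  coefficient itself.\<close>

lemma vars_le_coeff: "vars_le (int d) (pd_coeff A k)"
proof (induction "nat (int d - k)" arbitrary: k rule: less_induct)
  case less
  consider "k < 0" | "k > int d" | "k = int d" | "0 \<le> k" "k < int d" by linarith
  then show ?case
  proof cases
    case 4
    have "vars_le (int d) (lax_term (k + int (gap i)) i)" for i
    proof (cases "k + int (gap i) \<le> int d")
      case True
      have le: "vars_le (int d) (pd_coeff A (k + int (gap i)))"
        using gap_pos[of i] True by (intro less) simp
      show ?thesis
        using True le by (intro vars_le_diff vars_le_mult vars_le_dvar) (auto intro: vars_le_mono[OF le])
    qed (simp add: above)
    then have "vars_le (int d) (- (\<Sum>i\<in>UNIV. lax_term (k + int (gap i)) i))"
      unfolding vars_le_uminus by (intro vars_le_sum)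
    moreover have "k - int N \<notin> range (\<lambda>i. - int (Ns i))" using 4 N_notin_range by simp
    then have "pd_coeff A k - shift (- int N) (pd_coeff A k)
        = - (\<Sum>i\<in>UNIV. lax_term (k + int (gap i)) i)"
      using lax_equation by (simp add: eq_neg_iff_add_eq_0)
    ultimately have "vars_le (int d) (pd_coeff A k - shift (- int N) (pd_coeff A k))"
      by metis
    then show ?thesis by (rule vars_le_diff_shift[OF N_pos])
  qed (simp_all add: neg above top)
qed

text \<open>The shifted factor does not see \<open>x\<close>, and \<open>dvar i 0\<close> has value
  -1 as \<open>d > 0\<close>. The variable \<open>dvar i t\<close> has value -1 for
  \<open>t < d\<close> and \<open>-x\<close> for \<open>t = d\<close>, where the coefficient is the
  constant \<open>c\<close>.\<close>

lemma delta_lax_term: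
  "delta (lax_term t i)
     = (if t < int d then - delta (pd_coeff A t) else if t = int d then - c else 0)"
proof -
  have z: "cx.poly_eval (test_val x) (shift (- int n) (pd_coeff A t))
      = cx.poly_eval (test_val 1) (shift (- int n) (pd_coeff A t))" if "n > 0" for x n
    by (rule eval_vars_le[of "int d - int n"]) (use that vars_le_coeff[of t] in simp_all)
  have "Ns i > 0" using N_less[of i] by simp
  then have e: "cx.poly_eval (test_val x) (lax_term t i)
      = cx.poly_eval (test_val x) (pd_coeff A t) * test_val x (i, t)
        + cx.poly_eval (test_val 1) (shift (- int (Ns i)) (pd_coeff A t))" for x
    using d_pos z[of "Ns i" x]
    by (simp add: cx.poly_eval_diff cx.poly_eval_mult cx.poly_eval_dvar) (simp add: test_val_def)
  consider "t < int d" | "t = int d" | "t > int d" by linarith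
  then show ?thesis
  proof cases
    case 3
    then show ?thesis by (simp add: above)
  qed (unfold delta_def e, simp_all add: test_val_def top cx.poly_eval_dconst)
qed

text \<open>The recursion adds natural multiples of \<open>c\<close>, so nothing cancels; the
  multiplier counts the ordered ways to reach \<open>d - k\<close> by adding gaps.\<close>

lemma delta_coeff:
  assumes "0 \<le> k" "k < int d"
  shows "\<exists>z::nat. delta (pd_coeff A k) = c * of_nat z \<and>
    (nat (int d - k) \<in> semigroup_gen (range gap) \<longrightarrow> 0 < z)"
  using assms
proof (induction "nat (int d - k)" arbitrary: k rule: less_induct)
  case less
  have "\<exists>w::nat. delta (lax_term (k + int (gap i)) i) = - (c * of_nat w) \<and>
    (int (gap i) \<le> int d - k \<and> nat (int d - k) - gap i \<in> semigroup_gen (range gap) \<longrightarrow> 0 < w)" for i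
  proof -
    consider "k + int (gap i) < int d" | "k + int (gap i) = int d" | "k + int (gap i) > int d"
      by linarith
    then show ?thesis
    proof cases
      case 1
      then obtain z :: nat where z: "delta (pd_coeff A (k + int (gap i))) = c * of_nat z"
        "nat (int d - (k + int (gap i))) \<in> semigroup_gen (range gap) \<longrightarrow> 0 < z"
        using less.hyps[of "k + int (gap i)"] less.prems gap_pos[of i] by auto
      have "nat (int d - (k + int (gap i))) = nat (int d - k) - gap i" by simp
      then show ?thesis using z 1 by (intro exI[of _ z]) (simp add: delta_lax_term)
    next
      case 2
      then show ?thesis by (intro exI[of _ 1]) (simp add: delta_lax_term)
    next
      case 3
      then show ?thesis by (intro exI[of _ 0]) (simp add: delta_lax_term)
    qed
  qed
  then obtain w :: "'m \<Rightarrow> nat" where w: "\<And>i. delta (lax_term (k + int (gap i)) i) = - (c * of_nat (w i))"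
    "\<And>i. int (gap i) \<le> int d - k \<Longrightarrow> nat (int d - k) - gap i \<in> semigroup_gen (range gap) \<Longrightarrow> 0 < w i"
    by metis
  have "k - int N \<notin> range (\<lambda>i. - int (Ns i))" using less.prems N_notin_range by simp
  then have "delta (pd_coeff A k - shift (- int N) (pd_coeff A k)
      + (\<Sum>i\<in>UNIV. lax_term (k + int (gap i)) i)) = 0"
    using lax_equation delta_0 by presburger
  moreover have "delta (shift (- int N) (pd_coeff A k)) = 0"
    by (rule delta_vars_le[of "int d - int N"]) (use vars_le_coeff[of k] N_pos in simp_all)
  ultimately have "delta (pd_coeff A k) = c * of_nat (\<Sum>i\<in>UNIV. w i)"
    unfolding delta_add delta_sum w(1) by (simp add: delta_diff sum_negf sum_distrib_left)
  moreover have "0 < (\<Sum>i\<in>UNIV. w i)" if s: "nat (int d - k) \<in> semigroup_gen (range gap)"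
    using s
  proof cases
    case zero
    then show ?thesis using less.prems by simp
  next
    case (step x t)
    then obtain i where i: "t = gap i" by blast
    have "int (gap i) \<le> int d - k" using step(1) less.prems unfolding i by linarith
    moreover have "nat (int d - k) - gap i = x" using step(1) i by simp
    ultimately have "0 < w i" using step(2) by (intro w(2)) simp_all
    then show ?thesis by (metis finite sum_eq_0_iff UNIV_I neq0_conv)
  qed
  ultimately show ?case by blast
qed

text \<open>Otherwise the commutator vanishes at order \<open>-N-s\<close>. There
  \<open>pd_coeff A (- int s)\<close> is 0, and the remaining terms are natural multiples of
  \<open>-c\<close>, with a nonzero one at \<open>i0\<close> by the semigroup condition.\<close>

lemma mem_range_Ns:
  assumes "0 < s" "s \<le> gap i0" "gap i0 < d + s" "d + s - gap i0 \<in> semigroup_gen (range gap)"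
    and small: "\<And>i. gap i \<le> gap i0"
  shows "N + s \<in> range Ns"
proof (rule ccontr)
  assume "N + s \<notin> range Ns"
  have r: "- int s - int N \<notin> range (\<lambda>i. - int (Ns i))"
  proof
    assume "- int s - int N \<in> range (\<lambda>i. - int (Ns i))"
    then obtain i where "- int s - int N = - int (Ns i)" by blast
    then have "N + s = Ns i" by linarith
    with \<open>N + s \<notin> range Ns\<close> show False by blast
  qed
  have "\<exists>w::nat. delta (lax_term (- int s + int (gap i)) i) = - (c * of_nat w) \<and> (i = i0 \<longrightarrow> 0 < w)" for i
  proof (cases "gap i < s")
    case True
    then show ?thesis using neg[of "- int s + int (gap i)"] assms(2)
      by (intro exI[of _ 0]) auto
  next
    case False
    then have t: "0 \<le> - int s + int (gap i)" "- int s + int (gap i) < int d"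
      using assms(3) small[of i] by auto
    obtain z :: nat where z: "delta (pd_coeff A (- int s + int (gap i))) = c * of_nat z"
      "nat (int d - (- int s + int (gap i))) \<in> semigroup_gen (range gap) \<longrightarrow> 0 < z"
      using delta_coeff[OF t] by blast
    have "nat (int d - (- int s + int (gap i0))) = d + s - gap i0" by simp
    then show ?thesis using z t assms(4) by (intro exI[of _ z]) (auto simp: delta_lax_term)
  qed
  then obtain w :: "'m \<Rightarrow> nat" where w: "\<And>i. delta (lax_term (- int s + int (gap i)) i) = - (c * of_nat (w i))"
    "0 < w i0"
    by metis
  have "pd_coeff A (- int s) = 0" using neg assms(1) by simp
  then have "delta (\<Sum>i\<in>UNIV. lax_term (- int s + int (gap i)) i) = 0"
    using lax_equation[OF r] by simp
  then have "c * of_nat (\<Sum>i\<in>UNIV. w i) = 0"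
    unfolding delta_sum w(1) by (simp add: sum_negf sum_distrib_left)
  then have "(\<Sum>i\<in>UNIV. w i) = 0" using c_nonzero by (simp del: of_nat_sum)
  then show False using w(2) by (metis finite sum_eq_0_iff UNIV_I neq0_conv)
qed

end

context lax_operator
begin

lemma arithmetic_support:
  assumes F: "infinite F" "F \<subseteq> {D. lax_flow N Ns D}" "flows.independent F"
    and p: "p = Gcd (range (\<lambda>i. Ns i - N))" and i0: "\<And>i. Ns i \<le> Ns i0"
  shows "range Ns = {N + j * p |j. 1 \<le> j \<and> j \<le> (Ns i0 - N) div p}"
proof -
  let ?gap = "\<lambda>i. Ns i - N"
  obtain B where B: "\<And>n. n \<ge> B \<Longrightarrow> p dvd n \<Longrightarrow> n \<in> semigroup_gen (range ?gap)"
    using semigroup_gen_conductor[of "range ?gap"] p by auto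
  \<comment> \<open>With this order, \<open>d + s - ?gap i0\<close> exceeds \<open>B\<close> for
    every \<open>s\<close>, so divisibility by \<open>p\<close> suffices for membership in the
    semigroup.\<close>
  obtain A d c where d: "B + ?gap i0 < d" and A: "lax_flow_op A" "\<And>k. k < 0 \<Longrightarrow> pd_coeff A k = 0"
    "\<And>k. k > int d \<Longrightarrow> pd_coeff A k = 0" "pd_coeff A (int d) = dconst c" "c \<noteq> 0"
    by (rule flow_of_large_order[OF F, where b = "B + ?gap i0"]) (rule that)
  interpret positive_flow N Ns A d c
    by unfold_locales (use A d in auto)
  have gap: "gap = ?gap" by (simp add: gap_def fun_eq_iff)
  have pdvd: "p dvd ?gap i" for i
    unfolding p by (rule Gcd_dvd) simp
  have "0 < ?gap i0" using N_less[of i0] by simp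
  then have p_pos: "0 < p" and p_le: "p \<le> ?gap i0"
    using pdvd[of i0] by (auto intro: dvd_imp_le intro!: Nat.gr0I)
  have mem: "N + s \<in> range Ns" if "0 < s" "s \<le> ?gap i0" "p dvd d + s" for s
  proof (rule mem_range_Ns[of s i0])
    have "p dvd d + s - ?gap i0" by (rule dvd_diff_nat[OF that(3) pdvd])
    then show "d + s - gap i0 \<in> semigroup_gen (range gap)"
      unfolding gap using d by (intro B) auto
  qed (use that d i0 in \<open>auto simp: gap diff_le_mono\<close>)
  have "p dvd d"
  proof -
    \<comment> \<open>The least positive \<open>s\<close> with \<open>p dvd d + s\<close>. It turns
      out to be a gap, hence a multiple of \<open>p\<close>, which forces
      \<open>p dvd d\<close>.\<close>
    define s where "s = p - d mod p"
    have s: "0 < s" "s \<le> p" using p_pos by (auto simp: s_def)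
    have "d + s = p * (d div p) + p"
      unfolding s_def using p_pos by (metis add.assoc le_add_diff_inverse less_imp_le_nat mod_less_divisor mult_div_mod_eq)
    then have ds: "p dvd d + s" by simp
    have "N + s \<in> range Ns" using s p_le ds by (intro mem) auto
    then obtain i where "Ns i = N + s" by auto
    then have "p dvd s" using pdvd[of i] by simp
    then show ?thesis using ds by (simp add: dvd_add_left_iff)
  qed
  show ?thesis
  proof (intro equalityI subsetI)
    fix x assume "x \<in> range Ns"
    then obtain i where x: "x = Ns i" by blast
    obtain j where j: "?gap i = j * p" using pdvd[of i] by (metis dvd_def mult.commute)
    have xj: "x = N + j * p" using j N_less[of i] x by simp
    have "j \<noteq> 0" using j N_less[of i] by (cases j) auto
    moreover have "j \<le> ?gap i0 div p"
      using p_pos diff_le_mono[OF i0[of i], of N] unfolding j by (simp add: less_eq_div_iff_mult_less_eq)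
    ultimately show "x \<in> {N + j * p |j. 1 \<le> j \<and> j \<le> ?gap i0 div p}"
      using xj by auto
  next
    fix x assume "x \<in> {N + j * p |j. 1 \<le> j \<and> j \<le> ?gap i0 div p}"
    then obtain j where j: "x = N + j * p" "1 \<le> j" "j \<le> ?gap i0 div p" by blast
    have "j * p \<le> ?gap i0"
      using j(3) p_pos by (simp add: less_eq_div_iff_mult_less_eq)
    then show "x \<in> range Ns"
      unfolding j(1) using j(2) p_pos \<open>p dvd d\<close> by (intro mem) auto
  qed
qed

end


section \<open>The hierarchy\<close>

lemma pos_part_diff: "pos_part (P - Q) = pos_part P - pos_part Q"
  by (rule psdo_eqI) simp

lemma pos_part_commutator_pos:
  assumes "\<And>k. k < 0 \<Longrightarrow> pd_coeff P k = 0" "\<And>k. k < 0 \<Longrightarrow> pd_coeff Q k = 0"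
  shows "pos_part (commutator P Q) = commutator P Q"
proof -
  have "pd_coeff (P' * Q') n = 0"
    if n: "n < 0" and PQ: "\<And>k. k < 0 \<Longrightarrow> pd_coeff P' k = 0" "\<And>k. k < 0 \<Longrightarrow> pd_coeff Q' k = 0"
    for P' Q' :: "'a psdo" and n
  proof (rule ccontr)
    assume "pd_coeff (P' * Q') n \<noteq> 0"
    then obtain k where "pd_coeff P' k \<noteq> 0" "pd_coeff Q' (n - k) \<noteq> 0"
      by (rule pd_coeff_mult_nonzero)
    then have "\<not> k < 0" "\<not> n - k < 0" using PQ by blast+
    with n show False by simp
  qed
  then show ?thesis
    using assms by (intro psdo_eqI) (simp add: commutator_def)
qed

lemma pos_part_commutator_neg:
  assumes "\<And>k. k \<ge> 0 \<Longrightarrow> pd_coeff P k = 0" "\<And>k. k \<ge> 0 \<Longrightarrow> pd_coeff Q k = 0"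
  shows "pos_part (commutator P Q) = 0"
proof -
  have "pd_coeff (P * Q) n = 0" "pd_coeff (Q * P) n = 0" if "n \<ge> 0" for n
    using that assms by (auto intro!: pd_coeff_mult_above[of "- 1" _ "- 1"])
  then show ?thesis
    by (intro psdo_eqI) (simp add: commutator_def)
qed

text \<open>Splitting \<open>P\<close> and \<open>Q\<close> in \<open>commutator P Q = 0\<close>
  leaves the commutator of the two negative parts as the only error, and it has negative
  order.\<close>

lemma pos_part_zero_curvature:
  assumes "P * Q = Q * P"
  shows "pos_part (commutator (pos_part P) Q) - pos_part (commutator (pos_part Q) P)
    = commutator (pos_part P) (pos_part Q)"
proof -
  let ?A = "pos_part P" and ?B = "pos_part Q"
  have "commutator ?A Q - commutator ?B P
      = commutator ?A ?B - commutator (P - ?A) (Q - ?B) + commutator P Q"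
    by (simp add: commutator_def algebra_simps)
  moreover have "commutator P Q = 0"
    using assms by (simp add: commutator_def)
  ultimately have "commutator ?A Q - commutator ?B P = commutator ?A ?B - commutator (P - ?A) (Q - ?B)"
    by simp
  then have "pos_part (commutator ?A Q) - pos_part (commutator ?B P)
      = pos_part (commutator ?A ?B) - pos_part (commutator (P - ?A) (Q - ?B))"
    by (simp flip: pos_part_diff)
  also have "pos_part (commutator ?A ?B) = commutator ?A ?B"
    by (rule pos_part_commutator_pos) simp_all
  also have "pos_part (commutator (P - ?A) (Q - ?B)) = 0"
    by (rule pos_part_commutator_neg) simp_all
  finally show ?thesis by simp
qed

lemma choose_add_ge: "a + 1 \<le> (a + Suc b) choose Suc b"
proof (induction b)
  case (Suc b)
  have "(a + Suc b) choose Suc b \<le> (a + Suc (Suc b)) choose Suc (Suc b)"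
    by simp
  with Suc show ?case by linarith
qed simp

context lax_operator
begin

section \<open>Powers of the inverse of \<open>L\<close> and their support\<close>

definition inv_power :: "nat \<Rightarrow> 'm psdo" where
  "inv_power n = pd_inverse L ^ n"

lemma L_inverse: "L * pd_inverse L = 1" "pd_inverse L * L = 1"
  using monic_pd_inverse[OF pd_coeff_L_N pd_coeff_L_above] by blast+

lemma inv_power_commute_L: "inv_power n * L = L * inv_power n"
  unfolding inv_power_def by (rule power_commuting_commutes) (simp add: L_inverse)

lemma inv_power_commute: "inv_power k * inv_power n = inv_power n * inv_power k"
  unfolding inv_power_def by (simp flip: power_add add: add.commute)

lemma inv_power_Suc_mult_L: "inv_power (Suc n) * L = inv_power n"
  by (simp add: inv_power_def power_Suc2 mult.assoc L_inverse del: power_Suc)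

text \<open>Comparing coefficients in \<open>inv_power (Suc n) * L = inv_power n\<close> gives a
  recursion downward in \<open>t\<close>.\<close>

lemma inv_power_coeff_Suc:
  "pd_coeff (inv_power (Suc n)) t = pd_coeff (inv_power n) (t - int N)
     - (\<Sum>i\<in>UNIV. pd_coeff (inv_power (Suc n)) (t + int (Ns i - N)) * dvar i (t + int (Ns i - N)))"
proof -
  have eq: "t + int (Ns i - N) = t - int N + int (Ns i)" for i
    using N_less[of i] by simp
  show ?thesis
    unfolding eq using pd_coeff_mult_L[of "inv_power (Suc n)" "t - int N"]
    by (simp add: inv_power_Suc_mult_L)
qed

lemma inv_power_supp:
  assumes gap: "\<And>i. p dvd Ns i - N"
  shows "pd_coeff (inv_power n) t \<noteq> 0 \<Longrightarrow> \<exists>j. t = int (n * N) - int (j * p)"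
proof (induction n arbitrary: t)
  case 0
  then show ?case by (simp add: inv_power_def split: if_splits)
next
  case (Suc n)
  obtain b where b: "\<And>t. t > b \<Longrightarrow> pd_coeff (inv_power (Suc n)) t = 0"
    using pd_coeff_bound by blast
  show ?case
    using Suc.prems
  proof (induction "nat (b - t)" arbitrary: t rule: less_induct)
    case less
    consider "pd_coeff (inv_power n) (t - int N) \<noteq> 0"
      | i where "pd_coeff (inv_power (Suc n)) (t + int (Ns i - N)) \<noteq> 0"
    proof (rule ccontr)
      assume *: "\<not> thesis"
      then have "pd_coeff (inv_power n) (t - int N) = 0"
        "pd_coeff (inv_power (Suc n)) (t + int (Ns i - N)) = 0" for i
        using that by blast+
      then have "pd_coeff (inv_power (Suc n)) t = 0"
        by (subst inv_power_coeff_Suc) simp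
      with less.prems show False by simp
    qed
    then show ?case
    proof cases
      case 1
      then obtain j where "t - int N = int (n * N) - int (j * p)" using Suc.IH by blast
      then have "t = int (Suc n * N) - int (j * p)" by simp
      then show ?thesis by blast
    next
      case 2
      have "0 < Ns i - N" using N_less[of i] by simp
      moreover have "t + int (Ns i - N) \<le> b" using b 2 by force
      ultimately have "nat (b - (t + int (Ns i - N))) < nat (b - t)" by linarith
      then obtain j where j: "t + int (Ns i - N) = int (Suc n * N) - int (j * p)"
        using less.hyps[OF _ 2] by blast
      obtain l where l: "Ns i - N = p * l" using gap[of i] by blast
      have "t = int (Suc n * N) - int ((j + l) * p)"
        using j unfolding l by (simp add: algebra_simps)
      then show ?thesis by blast
    qed
  qed
qed

text \<open>As \<open>P\<close> commutes with \<open>L\<close>, the commutator equals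
  \<open>L * ?R - ?R * L\<close> with \<open>?R\<close> the negative part, so its orders lie below
  \<open>-N\<close>. Computed from the nonnegative part they have the form \<open>-N - s * p\<close>
  with \<open>s \<le> m\<close>.\<close>

lemma lax_flow_op_pos_part:
  assumes arith: "range Ns = {N + j * p |j. 1 \<le> j \<and> j \<le> m}"
    and com: "P * L = L * P" and supp: "\<And>k. pd_coeff P k \<noteq> 0 \<Longrightarrow> int p dvd k"
  shows "lax_flow_op (pos_part P)"
proof (intro allI impI, rule ccontr)
  fix k assume k: "k \<notin> range (\<lambda>i. - int (Ns i))" and nz: "pd_coeff (commutator (pos_part P) L) k \<noteq> 0"
  let ?R = "P - pos_part P"
  have "k < - int N"
  proof (rule ccontr)
    assume "\<not> k < - int N"
    then have "pd_coeff (?R * L) k = 0"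
      by (intro pd_coeff_mult_above[of "- 1" _ "- int N"]) (auto simp: pd_coeff_L_above)
    moreover have "pd_coeff (L * ?R) k = 0"
      using \<open>\<not> k < - int N\<close>
      by (intro pd_coeff_mult_above[of "- int N" _ "- 1"]) (auto simp: pd_coeff_L_above)
    moreover have "commutator (pos_part P) L = L * ?R - ?R * L"
      by (simp add: commutator_def left_diff_distrib right_diff_distrib com)
    ultimately show False using nz by simp
  qed
  have L_supp: "\<exists>l\<le>m. r = - int N - int (l * p)" if r: "pd_coeff L r \<noteq> 0" for r
  proof (cases "r = - int N")
    case False
    then obtain i where i: "r = - int (Ns i)" using r pd_coeff_L_0 by blast
    then obtain j where "Ns i = N + j * p" "j \<le> m" using arith by blast
    then show ?thesis using i by auto
  qed auto
  have "\<exists>j l. 0 \<le> j \<and> int p dvd j \<and> l \<le> m \<and> k = j - int N - int (l * p)"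
  proof -
    have "pd_coeff (pos_part P * L) k \<noteq> 0 \<or> pd_coeff (L * pos_part P) k \<noteq> 0"
      using nz by (auto simp: commutator_def)
    then obtain j where "pd_coeff (pos_part P) j \<noteq> 0" "pd_coeff L (k - j) \<noteq> 0"
    proof
      assume "pd_coeff (L * pos_part P) k \<noteq> 0"
      then obtain j where "pd_coeff L j \<noteq> 0" "pd_coeff (pos_part P) (k - j) \<noteq> 0"
        by (rule pd_coeff_mult_nonzero)
      then show thesis using that[of "k - j"] by simp
    qed (erule pd_coeff_mult_nonzero)
    then have j: "0 \<le> j" "int p dvd j" and L: "pd_coeff L (k - j) \<noteq> 0"
      using supp[of j] by (auto split: if_splits)
    obtain l where "l \<le> m" "k - j = - int N - int (l * p)" using L_supp[OF L] by blast
    then show ?thesis using j by (intro exI[of _ j] exI[of _ l]) simp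
  qed
  then obtain j' l where kl: "0 \<le> int p * j'" "l \<le> m" "k = int p * j' - int N - int (l * p)"
    by (auto elim!: dvdE)
  have eq: "k = - int N - int p * (int l - j')"
    using kl(3) by (simp add: algebra_simps)
  have "0 < int p * (int l - j')" using eq \<open>k < - int N\<close> by linarith
  then have p: "0 < int p" and lj: "0 < int l - j'"
    by (auto simp: zero_less_mult_iff)
  have "0 \<le> j'" using kl(1) p by (simp add: zero_le_mult_iff)
  define s where "s = nat (int l - j')"
  have s: "1 \<le> s" "s \<le> m" "int s = int l - j'"
    using lj kl(2) \<open>0 \<le> j'\<close> by (auto simp: s_def)
  have "N + s * p \<in> range Ns" unfolding arith using s by blast
  then obtain i where "Ns i = N + s * p" by (metis rangeE)
  then have "k = - int (Ns i)" using eq s(3) by (simp add: mult.commute)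
  with k show False by blast
qed

text \<open>Comparing coefficients turns the Lax equation into prescribed values on the generators,
  the form in which existence and uniqueness of derivations apply.\<close>

lemma lax_flow_by_iff:
  "lax_flow_by N Ns A D \<longleftrightarrow> is_derivation D \<and> (\<forall>f. D (shift 1 f) = shift 1 (D f)) \<and> is_diffop A \<and>
     lax_flow_op A \<and> (\<forall>i. D (dvar i 0) = pd_coeff (commutator A L) (- int (Ns i)))"
proof -
  have "deriv_lax_op Ns D = commutator A L" if "lax_flow_op A"
    "\<And>i. D (dvar i 0) = pd_coeff (commutator A L) (- int (Ns i))"
  proof (rule psdo_eqI)
    fix k
    show "pd_coeff (deriv_lax_op Ns D) k = pd_coeff (commutator A L) k"
    proof (cases "k \<in> range (\<lambda>i. - int (Ns i))")
      case True
      then show ?thesis using that(2) deriv_lax_op_coeff by auto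
    next
      case False
      then show ?thesis using that(1) by (simp add: deriv_lax_op_def pd_coeff_sum_monom_0)
    qed
  qed
  moreover have "pd_supp (commutator A L) \<subseteq> pd_supp L" if "lax_flow_op A"
    using that unfolding pd_supp_L by (auto simp: pd_supp_def)
  moreover have "lax_flow_op A \<and> (\<forall>i. D (dvar i 0) = pd_coeff (commutator A L) (- int (Ns i)))"
    if "deriv_lax_op Ns D = commutator A L"
    using deriv_lax_op_flow[OF that] deriv_lax_op_coeff[of D] that by metis
  ultimately show ?thesis
    unfolding lax_flow_by_def by blast
qed

lemma lax_flow_by_exists:
  assumes "is_diffop A" "lax_flow_op A"
  obtains D where "lax_flow_by N Ns A D"
proof (rule derivation_exists[of "\<lambda>i. pd_coeff (commutator A L) (- int (Ns i))"])
  fix D assume "is_derivation D" "\<And>f. D (shift 1 f) = shift 1 (D f)"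
    "\<And>i. D (dvar i 0) = pd_coeff (commutator A L) (- int (Ns i))"
  then show thesis using assms by (intro that[of D]) (simp add: lax_flow_by_iff)
qed

lemma lax_flow_by_unique:
  assumes "lax_flow_by N Ns A D" "lax_flow_by N Ns A D'"
  shows "D = D'"
proof -
  \<comment> \<open>The scalar 1 brings the difference into the form of
    \<open>derivation_diff_scale\<close>.\<close>
  let ?E = "D - scale_map 1 D'"
  have "is_derivation ?E"
    using assms unfolding lax_flow_by_iff by (intro derivation_diff_scale) auto
  moreover have "?E (shift 1 f) = shift 1 (?E f)" for f
    using assms unfolding lax_flow_by_iff by (simp add: scale_map_def shift_diff)
  moreover have "?E (dvar i 0) = 0" for i
    using assms unfolding lax_flow_by_iff by (simp add: scale_map_def)
  ultimately have "?E f = 0" for f by (rule derivation_zeroI)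
  then show ?thesis by (intro ext) (simp add: scale_map_def)
qed

section \<open>Flows acting on operators\<close>

lemma pd_map_L:
  assumes "lax_flow_by N Ns A D"
  shows "pd_map D L = commutator A L"
proof (rule psdo_eqI)
  fix k
  have D: "is_derivation D" "lax_flow_op A"
    "\<And>i. D (dvar i 0) = pd_coeff (commutator A L) (- int (Ns i))"
    using assms unfolding lax_flow_by_iff by auto
  consider "k = - int N" | i where "k = - int (Ns i)"
    | "k \<noteq> - int N" "k \<notin> range (\<lambda>i. - int (Ns i))" by blast
  then show "pd_coeff (pd_map D L) k = pd_coeff (commutator A L) k"
  proof cases
    case 1
    then have "pd_coeff (commutator A L) k = 0" using D(2) N_notin_range[of k] by simp
    then show ?thesis by (simp add: pd_coeff_pd_map D 1 pd_coeff_L_N derivation_1)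
  next
    case 2
    then show ?thesis by (simp add: pd_coeff_pd_map D(1) pd_coeff_L_Ns D(3))
  next
    case 3
    then show ?thesis using D(2) by (simp add: pd_coeff_pd_map D(1) pd_coeff_L_0 derivation_0)
  qed
qed

text \<open>Differentiating \<open>L * pd_inverse L = 1\<close> settles the inverse; powers follow
  from the Leibniz rule.\<close>

lemma pd_map_inv_power:
  assumes "lax_flow_by N Ns A D"
  shows "pd_map D (inv_power n) = commutator A (inv_power n)"
proof -
  have D: "is_derivation D" "\<And>f. D (shift 1 f) = shift 1 (D f)"
    using assms unfolding lax_flow_by_iff by auto
  let ?X = "pd_inverse L"
  have "0 = pd_map D (L * ?X)"
    by (simp add: L_inverse pd_map_1 D)
  also have "\<dots> = commutator A L * ?X + L * pd_map D ?X"
    by (simp only: pd_map_mult[OF D] pd_map_L[OF assms])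
  finally have "L * pd_map D ?X = - (commutator A L * ?X)"
    by (simp add: eq_neg_iff_add_eq_0 add.commute)
  then have "?X * (L * pd_map D ?X) = ?X * (- (commutator A L * ?X))"
    by (rule arg_cong)
  then have "(?X * L) * pd_map D ?X = (?X * L) * A * ?X - ?X * A * (L * ?X)"
    by (simp only: commutator_def) (simp add: algebra_simps)
  then have X: "pd_map D ?X = commutator A ?X"
    by (simp add: L_inverse commutator_def)
  show ?thesis
    unfolding inv_power_def
  proof (induction n)
    case (Suc n)
    have "pd_map D (?X ^ Suc n) = commutator A ?X * ?X ^ n + ?X * commutator A (?X ^ n)"
      by (simp only: power_Suc pd_map_mult[OF D] X Suc)
    then show ?case by (simp add: commutator_def algebra_simps)
  qed (simp add: pd_map_1 D commutator_def)
qed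

text \<open>Zero curvature and the Jacobi identity make the two mixed derivatives of
  \<open>L\<close> agree. So \<open>C\<close>, a derivation commuting with the shift, vanishes on
  the generators.\<close>

lemma flows_commute:
  assumes D: "lax_flow_by N Ns (pos_part (inv_power k)) D"
    and E: "lax_flow_by N Ns (pos_part (inv_power n)) E"
  shows "D \<circ> E = E \<circ> D"
proof -
  let ?A = "pos_part (inv_power k)" and ?B = "pos_part (inv_power n)"
  have dD: "is_derivation D" "\<And>f. D (shift 1 f) = shift 1 (D f)"
    and dE: "is_derivation E" "\<And>f. E (shift 1 f) = shift 1 (E f)"
    using D E unfolding lax_flow_by_iff by auto
  have "pd_map D ?B - pd_map E ?A = commutator ?A ?B"
    using pos_part_zero_curvature[OF inv_power_commute[of k n]]
    by (simp add: pd_map_pos_part dD(1) dE(1) pd_map_inv_power[OF D] pd_map_inv_power[OF E])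
  then have zc: "pd_map D ?B = commutator ?A ?B + pd_map E ?A"
    by (simp add: algebra_simps)
  have DB: "pd_map D (pd_map E L) = commutator (pd_map D ?B) L + commutator ?B (commutator ?A L)"
    unfolding pd_map_L[OF E] commutator_def[of ?B L]
    by (simp add: pd_map_diff[OF dD(1)] pd_map_mult[OF dD] pd_map_L[OF D])
       (simp add: commutator_def algebra_simps)
  have EA: "pd_map E (pd_map D L) = commutator (pd_map E ?A) L + commutator ?A (commutator ?B L)"
    unfolding pd_map_L[OF D] commutator_def[of ?A L]
    by (simp add: pd_map_diff[OF dE(1)] pd_map_mult[OF dE] pd_map_L[OF E])
       (simp add: commutator_def algebra_simps)
  have eq: "pd_map D (pd_map E L) = pd_map E (pd_map D L)"
    unfolding DB EA zc by (simp add: commutator_def algebra_simps)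
  define C where "C f = D (E f) - E (D f)" for f
  have C: "is_derivation C"
    unfolding is_derivation_def
  proof (intro conjI allI)
    show "C (dconst c * f) = dconst c * C f" for c f
      by (simp add: C_def derivation_dconst_mult[OF dD(1)] derivation_dconst_mult[OF dE(1)]
          right_diff_distrib)
  qed (simp_all add: C_def derivation_add[OF dD(1)] derivation_add[OF dE(1)]
        derivation_mult[OF dD(1)] derivation_mult[OF dE(1)] algebra_simps)
  have C_dvar: "C (dvar i 0) = 0" for i
    using arg_cong[OF eq, of "\<lambda>P. pd_coeff P (- int (Ns i))"]
    by (simp add: C_def pd_coeff_pd_map dD(1) dE(1) pd_coeff_L_Ns)
  have "C f = 0" for f
    by (rule derivation_zeroI[OF C _ C_dvar]) (simp add: C_def dD(2) dE(2) shift_diff)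
  then show ?thesis by (intro ext) (simp add: C_def)
qed

lemma Res_conserved:
  assumes "lax_flow_by N Ns A D"
  shows "D (Res (inv_power n)) \<in> range (\<lambda>f. shift 1 f - f)"
proof -
  have D: "is_derivation D" "is_diffop A"
    using assms unfolding lax_flow_by_iff by auto
  have "D (Res (inv_power n)) = Res (commutator A (inv_power n))"
    by (simp add: Res_def pd_coeff_pd_map D(1) flip: pd_map_inv_power[OF assms])
  then show ?thesis using Res_commutator_range[OF D(2)] by simp
qed

text \<open>
  At the point where the generator \<open>u\<^sub>1\<close> multiplying \<open>S\<^bsup>-N-p\<^esup>\<close> is \<open>-1\<close> and the others vanish,
  \<open>L\<^sup>-\<^sup>n\<close> becomes \<open>S\<^bsup>nN\<^esup> (1 - S\<^bsup>-p\<^esup>)\<^bsup>-n\<^esup>\<close> and has binomial coefficients.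
\<close>

lemma inv_power_eval:
  assumes gap: "\<And>i. p dvd Ns i - N" and i1: "Ns i1 = N + p"
  shows "cx.poly_eval (\<lambda>(i, j). if i = i1 then - 1 else 0)
      (pd_coeff (inv_power (Suc n)) (int (Suc n * N) - int (j * p))) = of_nat ((n + j) choose j)"
proof -
  let ?E = "cx.poly_eval (\<lambda>(i, j). if i = i1 then - 1 else 0)"
  define e where "e n t = ?E (pd_coeff (inv_power n) t)" for n t
  have p: "0 < p" using N_less[of i1] i1 by simp
  \<comment> \<open>At this point only \<open>i1\<close> survives in the sum, and the recursion
    becomes Pascal's rule.\<close>
  have e_Suc: "e (Suc n) t = e n (t - int N) + e (Suc n) (t + int p)" for n t
  proof -
    have "e (Suc n) t = e n (t - int N)
        - (\<Sum>i\<in>UNIV. e (Suc n) (t + int (Ns i - N)) * (if i = i1 then - 1 else 0))"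
      unfolding e_def by (subst inv_power_coeff_Suc)
        (simp add: cx.poly_eval_diff cx.poly_eval_sum cx.poly_eval_mult cx.poly_eval_dvar)
    also have "(\<Sum>i\<in>UNIV. e (Suc n) (t + int (Ns i - N)) * (if i = i1 then - 1 else 0))
        = - e (Suc n) (t + int p)"
      by (simp add: if_distrib[of "\<lambda>x. _ * x"] i1 cong: if_cong)
    finally show ?thesis by simp
  qed
  have e_0: "e 0 (- int (j * p)) = (if j = 0 then 1 else 0)" for j
    using p by (simp add: e_def inv_power_def cx.poly_eval_1)
  have e_above: "e n (int (n * N) + int p) = 0" for n
  proof -
    have "pd_coeff (inv_power n) (int (n * N) + int p) = 0"
    proof (rule ccontr)
      assume "pd_coeff (inv_power n) (int (n * N) + int p) \<noteq> 0"
      then obtain j where "int (n * N) + int p = int (n * N) - int (j * p)"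
        using inv_power_supp[OF gap] by blast
      then have "int p + int (j * p) = 0" by linarith
      then show False using p by linarith
    qed
    then show ?thesis by (simp add: e_def)
  qed
  have step: "e (Suc n) (int (Suc n * N) - int (Suc j * p))
      = e n (int (n * N) - int (Suc j * p)) + e (Suc n) (int (Suc n * N) - int (j * p))" for n j
    by (subst e_Suc) (simp add: algebra_simps)
  have step0: "e (Suc n) (int (Suc n * N)) = e n (int (n * N))" for n
    by (subst e_Suc) (use e_above[of "Suc n"] in simp)
  have "e (Suc n) (int (Suc n * N) - int (j * p)) = of_nat ((n + j) choose j)" for n j
  proof (induction n arbitrary: j)
    case 0
    show ?case
    proof (induction j)
      case 0
      show ?case using step0[of 0] e_0[of 0] by simp
    next
      case (Suc j)
      then show ?case using step[of 0 j] e_0[of "Suc j"] by simp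
    qed
  next
    case (Suc n)
    note IH = Suc
    show ?case
    proof (induction j)
      case 0
      show ?case using step0[of "Suc n"] IH[of 0] by simp
    next
      case (Suc j)
      show ?case
        by (simp only: step[of "Suc n" j] Suc IH[of "Suc j"]) simp
    qed
  qed
  then show ?thesis by (simp add: e_def)
qed

text \<open>With \<open>q * k = Suc n\<close> and \<open>q * k * N = Suc j * p\<close>, the density
  takes a binomial value of at least \<open>k\<close> at the chosen point. The values are unbounded,
  so the densities cannot form a finite set.\<close>

lemma infinite_densities:
  assumes gap: "\<And>i. p dvd Ns i - N" and i1: "Ns i1 = N + p" and q: "0 < q" "p dvd q * N"
  shows "infinite ((\<lambda>k. Res (inv_power (q * k))) ` {0<..})"
proof
  let ?h = "\<lambda>k. Res (inv_power (q * k))"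
  let ?E = "cx.poly_eval (\<lambda>(i, j). if i = i1 then - 1 else 0)"
  assume fin: "finite (?h ` {0<..})"
  have large: "real k \<le> norm (?E (?h k))" if k: "0 < k" for k
  proof -
    obtain n where n: "q * k = Suc n" using q(1) k by (metis mult_pos_pos gr0_implies_Suc)
    obtain b where b: "q * N = p * b" using q(2) by blast
    have "0 < p * b" using q(1) N_pos by (simp flip: b)
    then have "0 < b * k" using k by simp
    then obtain j where j: "b * k = Suc j" using gr0_implies_Suc by blast
    have "Suc n * N = k * (q * N)" by (simp flip: n)
    also have "\<dots> = Suc j * p" unfolding b by (simp flip: j)
    finally have "int (Suc n * N) - int (Suc j * p) = 0" by simp
    then have "?E (?h k) = of_nat ((n + Suc j) choose Suc j)"
      using inv_power_eval[OF gap i1, of n "Suc j"] by (simp only: Res_def n)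
    then have "norm (?E (?h k)) = real ((n + Suc j) choose Suc j)" by (simp only: norm_of_nat)
    moreover have "k \<le> n + 1" using n q(1) by (metis One_nat_def Suc_eq_plus1 Suc_leI mult_le_mono1 nat_mult_1)
    then have "k \<le> (n + Suc j) choose Suc j" using choose_add_ge[of n j] by linarith
    ultimately show ?thesis by simp
  qed
  have "finite ((\<lambda>f. norm (?E f)) ` ?h ` {0<..})" using fin by (rule finite_imageI)
  then obtain B where B: "\<And>x. x \<in> (\<lambda>f. norm (?E f)) ` ?h ` {0<..} \<Longrightarrow> x \<le> B"
    by (meson bdd_above.E bdd_above_finite)
  obtain k :: nat where k: "B < real k" using reals_Archimedean2 by blast
  have "real (Suc k) \<le> norm (?E (?h (Suc k)))" by (rule large) simp
  also have "\<dots> \<le> B" by (rule B) blast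
  finally show False using k by simp
qed

lemma hierarchy_exists:
  assumes arith: "range Ns = {N + j * p |j. 1 \<le> j \<and> j \<le> m}" and q: "p dvd q * N"
  obtains D where "lax_hierarchy N Ns q D"
proof -
  have gap: "p dvd Ns i - N" for i
  proof -
    obtain j where "Ns i = N + j * p" using arith by blast
    then show ?thesis by simp
  qed
  have "\<exists>D. lax_flow_by N Ns (pos_part (inv_power (q * k))) D" for k
  proof -
    \<comment> \<open>The leading order \<open>q * k * N\<close> is a multiple of \<open>p\<close>,
      and the support descends from it in steps of \<open>p\<close>.\<close>
    have "int p dvd t" if t: "pd_coeff (inv_power (q * k)) t \<noteq> 0" for t
    proof -
      obtain j where "t = int (q * k * N) - int (j * p)" using inv_power_supp[OF gap t] by blast
      moreover have "p dvd q * k * N" using q by (metis dvd_mult2 mult.assoc mult.commute)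
      ultimately show ?thesis by (metis dvd_diff dvd_triv_right of_nat_dvd_iff)
    qed
    then have "lax_flow_op (pos_part (inv_power (q * k)))"
      by (intro lax_flow_op_pos_part[OF arith inv_power_commute_L])
    then show ?thesis
      using lax_flow_by_exists[OF is_diffop_pos_part] by blast
  qed
  then obtain D where D: "\<And>k. lax_flow_by N Ns (pos_part (inv_power (q * k))) (D k)" by metis
  then have "lax_hierarchy N Ns q D"
    unfolding lax_hierarchy_def using flows_commute[OF D D] by (simp add: inv_power_def)
  then show thesis by (rule that)
qed

end

theorem theorem10:
  fixes N :: nat and Ns :: "'m::{finite,linorder} \<Rightarrow> nat" and p q m :: nat
  assumes "0 < N" and "\<And>i. N < Ns i" and "strict_mono Ns"
    and "p = Gcd (range (\<lambda>i. Ns i - N))"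
    and "q = p div gcd p N"
    and "m = (Ns (Max UNIV) - N) div p"
    and "\<exists>F. infinite F \<and> F \<subseteq> {D. lax_flow N Ns D} \<and> flows.independent F"
  shows "pd_supp (lax_op N Ns) = {- int N - int j * int p |j. j \<le> m} \<and>
    (\<exists>D. lax_hierarchy N Ns q D \<and>
      (\<forall>D'. lax_hierarchy N Ns q D' \<longrightarrow> (\<forall>k>0. D' k = D k)) \<and>
      (let h = (\<lambda>k. Res (pd_inverse (lax_op N Ns) ^ (q * k))) in
        infinite (h ` {0<..}) \<and>
        (\<forall>k>0. \<forall>k'>0. D k (h k') \<in> range (\<lambda>f. shift 1 f - f))))"
proof -
  interpret lax_operator N Ns
    using assms(1-3) by unfold_locales (simp_all add: strict_mono_imp_inj_on)
  have max: "Ns i \<le> Ns (Max UNIV)" for i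
    using assms(3) by (simp add: strict_mono_less_eq)
  have arith: "range Ns = {N + j * p |j. 1 \<le> j \<and> j \<le> m}"
    using assms(7) arithmetic_support[OF _ _ _ assms(4) max] unfolding assms(6) by blast
  have gap: "p dvd Ns i - N" for i
    unfolding assms(4) by (rule Gcd_dvd) simp
  \<comment> \<open>Here \<open>undefined\<close> is just some index; any gap is positive and
    divisible by \<open>p\<close>.\<close>
  have p: "0 < p"
    using gap[of undefined] assms(2)[of undefined] by (auto intro!: Nat.gr0I)
  \<comment> \<open>The existence of an index gives \<open>1 \<le> m\<close>, so
    \<open>N + p\<close> itself occurs.\<close>
  obtain j where "Ns undefined = N + j * p" "1 \<le> j" "j \<le> m" using arith by blast
  then have "N + 1 * p \<in> range Ns" unfolding arith by (intro CollectI exI[of _ 1]) auto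
  then obtain i1 where i1: "Ns i1 = N + p" by auto
  define g where "g = gcd p N"
  have g: "0 < g" "p = g * q" "g dvd N"
    using p by (auto simp: g_def assms(5))
  have q: "0 < q" using p g(2) by (intro Nat.gr0I) auto
  have qN: "p dvd q * N"
    using g by (metis dvd_refl mult.commute mult_dvd_mono)
  have "pd_supp L = {- int N - int j * int p |j. j \<le> m}"
  proof -
    let ?f = "\<lambda>j. - int N - int j * int p"
    have "range Ns = (\<lambda>j. N + j * p) ` {1..m}" unfolding arith by auto
    then have "(\<lambda>x. - int x) ` range Ns = (\<lambda>x. - int x) ` (\<lambda>j. N + j * p) ` {1..m}" by simp
    then have "range (\<lambda>i. - int (Ns i)) = ?f ` {1..m}" by (simp add: image_image)
    then have "pd_supp L = ?f ` insert 0 {1..m}" by (simp add: pd_supp_L)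
    also have "insert 0 {1..m} = {..m}" by auto
    finally show ?thesis by auto
  qed
  moreover obtain D where D: "lax_hierarchy N Ns q D"
    using hierarchy_exists[OF arith qN] by blast
  moreover have "D' k = D k" if "lax_hierarchy N Ns q D'" "k > 0" for D' k
    using that D unfolding lax_hierarchy_def
    by (intro lax_flow_by_unique[of "pos_part (pd_inverse L ^ (q * k))"]) simp_all
  moreover have "infinite ((\<lambda>k. Res (pd_inverse L ^ (q * k))) ` {0<..})"
    using infinite_densities[OF gap i1 q qN] by (simp add: inv_power_def)
  moreover have "D k (Res (pd_inverse L ^ (q * k'))) \<in> range (\<lambda>f. shift 1 f - f)" if "k > 0" for k k'
  proof -
    have "lax_flow_by N Ns (pos_part (pd_inverse L ^ (q * k))) (D k)"
      using D that unfolding lax_hierarchy_def by blast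
    then show ?thesis using Res_conserved by (simp add: inv_power_def)
  qed
  ultimately show ?thesis
    unfolding Let_def by blast
qed

end
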